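(* For $t\ge 0$, the cumulative distribution function $G_t(x)=P(S_t\le x)$ of the sale price $S_t$ is given by $$G_t(x)=\phi(\mu(t))\left[\frac{F_0(x)}{\phi(\mu_0)}+\int_{\mu_0}^{\mu(t)}\frac{[F(x)-F(w)]_+}{\phi(w)^2}\,dw\right]$$ $$=\phi(\mu(t))\frac{F_0(x)}{\phi(\mu_0)}+\phi(\mu(t))\cdot\begin{cases}0 & x<\mu_0\\ \frac{1}{\phi(x)}-\frac{1}{\phi(\mu_0)}+\phi'(x)\int_{\mu_0}^{x}\frac{dw}{\phi(w)^2} & \mu_0\le x<\mu(t)\\ \frac{1}{\phi(\mu(t))}-\frac{1}{\phi(\mu_0)}+\phi'(x)\int_{\mu_0}^{\mu(t)}\frac{dw}{\phi(w)^2} & x\ge\mu(t)\end{cases}$$ for all $x\in\mathbb{R}$. In case $F,F_0$ are absolutely continuous with densities $f,f_0$, the probability density function $g_t(x)$ of $S_t$ is given by $$g_t(x)=\phi(\mu(t))\frac{f_0(x)}{\phi(\mu_0)}+\phi(\mu(t))f(x)\cdot\begin{cases}0 & x<\mu_0\\ \int_{\mu_0}^{x}\frac{dw}{\phi(w)^2} & \mu_0\le x<\mu(t)\\ \int_{\mu_0}^{\mu(t)}\frac{dw}{\phi(w)^2} & x>\mu(t).\end{cases}$$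
   Context: Data: $\lambda>0$; $F,F_0$ are cumulative distribution functions (CDFs) on $\mathbb{R}$ (offer distribution and residual price distribution); $X\sim F$, $X_0\sim F_0$; $y_+=[y]_+=\max(y,0)$; $\mu_0=E[X_0]$; $M=\sup\{x : F(x)<1\}\in(-\infty,+\infty]$. Standing assumptions: $E[X_+]<\infty$, $E[|X_0|]<\infty$, $0\le\mu_0<M$. Define $\phi(x)=\int_x^\infty[1-F(u)]\,du$, with $\phi'(x)$ standing for $F(x)-1$, and $\Psi(x)=\int_{\mu_0}^x\frac{du}{\phi(u)}$ for $x\in[\mu_0,M)$. The optimal policy is the function $\mu:[0,\infty)\to[\mu_0,M)$, $\mu(t)=\Psi^{-1}(\lambda t)$; equivalently, the solution of $\mu'(t)=\lambda\phi(\mu(t))$, $\mu(0)=\mu_0$. Bidding process with marketing period $t\ge 0$ under the optimal policy: let $D_1,D_2,\dots$ be exponential with rate $\lambda$ (inter-arrival times of offers), $X_1,X_2,\dots$ be distributed according to $F$ (offer values), and $X_0$ be distributed according to $F_0$, all independent. The time remaining to the deadline when the $i$-th offer arrives is $t_i=\max(t_{i-1}-D_i,0)$, with initial value $t$ (that is, $t_i=(t-D_1-\dots-D_i)_+$). An offer $X_i$ with $t_i>0$ is accepted if and only if $X_i\ge\mu(t_i)$; at the first accepted offer $i$ the process ends, with realized sale price $S_t=X_i$. If no offer is accepted before the remaining time reaches $0$, then $S_t=X_0$. *)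

theory Defs
  imports "HOL-Probability.Probability"
begin

definition upper_end :: "(real \<Rightarrow> real) \<Rightarrow> ereal" where
  "upper_end F = Sup (ereal ` {x. F x < 1})"

definition phi :: "(real \<Rightarrow> real) \<Rightarrow> real \<Rightarrow> real" where
  "phi F x = (LBINT u:{x..}. 1 - F u)"

(* Only notation: phi F need not be differentiable at jumps of F. *)
definition phi_deriv :: "(real \<Rightarrow> real) \<Rightarrow> real \<Rightarrow> real" where
  "phi_deriv F x = F x - 1"

(* Meaningful for mu0 \<le> x < upper_end F; the integral is 0 for x < mu0. *)
definition Psi :: "(real \<Rightarrow> real) \<Rightarrow> real \<Rightarrow> real \<Rightarrow> real" where
  "Psi F mu0 x = (LBINT u:{mu0..x}. 1 / phi F u)"

definition optimal_policy :: "real \<Rightarrow> (real \<Rightarrow> real) \<Rightarrow> real \<Rightarrow> real \<Rightarrow> real" where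
  "optimal_policy lam F mu0 t =
     the_inv_into {x. mu0 \<le> x \<and> ereal x < upper_end F} (Psi F mu0) (lam * t)"

(* The next three definitions describe one realization of the bidding process:
   for i \<ge> 1, d i is the i-th inter-arrival time and x i the i-th offer, while
   x 0 is the residual price; d 0 is not used. *)

primrec remaining :: "real \<Rightarrow> (nat \<Rightarrow> real) \<Rightarrow> nat \<Rightarrow> real" where
  "remaining t d 0 = t"
| "remaining t d (Suc i) = max (remaining t d i - d (Suc i)) 0"

definition accepted ::
  "(real \<Rightarrow> real) \<Rightarrow> real \<Rightarrow> (nat \<Rightarrow> real) \<Rightarrow> (nat \<Rightarrow> real) \<Rightarrow> nat \<Rightarrow> bool" where
  "accepted mu t d x i \<longleftrightarrow>
     i \<ge> 1 \<and> remaining t d i > 0 \<and> x i \<ge> mu (remaining t d i)"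

(* The residual price is also used when no offer is accepted and the remaining time
   never reaches 0; for exponential inter-arrival times this has probability 0. *)
definition sale_price ::
  "(real \<Rightarrow> real) \<Rightarrow> real \<Rightarrow> (nat \<Rightarrow> real) \<Rightarrow> (nat \<Rightarrow> real) \<Rightarrow> real" where
  "sale_price mu t d x =
     (if \<exists>i. accepted mu t d x i then x (LEAST i. accepted mu t d x i) else x 0)"

end

theory Submission
  imports Defs
begin

text \<open>Fix \<open>x\<close> and let \<open>V s\<close> be the claimed value of \<open>P (S\<^sub>s \<le> x)\<close> for the remaining time \<open>s\<close>
(\<open>price_cdf\<close> below).  A seller with remaining time \<open>r\<close> waits an exponential time \<open>d\<close> for the next offer.
If \<open>d \<ge> r\<close>, the residual price is taken.  Otherwise the offer, compared with \<open>\<mu> (r - d)\<close>, either ends the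
process or leaves the same problem with remaining time \<open>r - d\<close>.  Hence \<open>V\<close> has to satisfy
\<open>V r = exp (- \<lambda> r) F\<^sub>0 x + \<integral>\<^sub>0\<^sup>r \<lambda> exp (- \<lambda> d) ((F x - F (\<mu> (r - d)))\<^sub>+ + F (\<mu> (r - d)) V (r - d)) dd\<close>.
The closed form does, because \<open>- exp (- \<lambda> d) V (r - d)\<close> is an antiderivative of the integrand: this is the product
rule together with \<open>\<mu>' = \<lambda> \<phi> (\<mu>)\<close> and \<open>\<phi>' = F - 1\<close> (\<open>price_cdf_has_derivative\<close>, \<open>renewal_equation\<close>).
At jumps of \<open>F\<close> these derivatives do not exist.  There are only countably many jumps, and \<open>\<mu>\<close> is injective, so a
fundamental theorem of calculus with a countable exceptional set (\<open>LBINT_FTC_off_countable\<close>) is enough.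

That the renewal equation determines the law is shown by a martingale argument, in place of a regeneration of the
whole process at the first arrival.  Let \<open>R\<^sub>n\<close> be the remaining time after \<open>n\<close> offers, set to \<open>-1\<close> once the object
is sold.  The renewal equation says exactly that
\<open>1(sold within the first n offers, at a price \<le> x) + 1(R\<^sub>n \<ge> 0) V (R\<^sub>n)\<close> has the same expectation for every \<open>n\<close>
(\<open>expected_total\<close>): only independence of \<open>R\<^sub>n\<close> from the next arrival time and offer enters.  For \<open>n = 0\<close> the
expectation is \<open>V t\<close>.  It differs from \<open>P (S\<^sub>t \<le> x)\<close> only by what happens on \<open>R\<^sub>n > 0\<close>, where all of the first \<open>n\<close>
inter-arrival times are smaller than \<open>t\<close>; this event has a geometrically small probability
(\<open>undecided_tendsto_0\<close>, \<open>sale_cdf\<close>).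

The explicit cases follow from \<open>(1/\<phi>)' = (1 - F)/\<phi>\<^sup>2\<close> (\<open>excess_integral_cases\<close>), and the density from exchanging
the order of integration in \<open>\<integral> (F x - F w)\<^sub>+ / \<phi>(w)\<^sup>2 dw\<close> after writing \<open>F x - F w\<close> as an integral of \<open>f\<close>
(\<open>sale_distributed\<close>).\<close>

section \<open>The fundamental theorem of calculus off a countable set\<close>

text \<open>If \<open>f b < f a\<close>, then uncountably many values lie strictly between them, so one of them, \<open>c\<close>, is not attained on the
exceptional set.  At the last point where \<open>f\<close> equals \<open>c\<close> the derivative is positive, so \<open>f\<close> exceeds \<open>c\<close>
just to the right of it and must cross \<open>c\<close> once more on the way down to \<open>f b\<close>.\<close>

lemma nondecreasing_of_pos_deriv_off_countable:
  fixes f :: "real \<Rightarrow> real"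
  assumes ab: "a \<le> b" and cont: "continuous_on {a..b} f" and S: "countable S"
    and der: "\<And>x. a < x \<Longrightarrow> x < b \<Longrightarrow> x \<notin> S \<Longrightarrow> \<exists>y>0. (f has_real_derivative y) (at x)"
  shows "f a \<le> f b"
proof (rule ccontr)
  assume "\<not> f a \<le> f b"
  then have "uncountable {f b<..<f a}" by (simp add: uncountable_open_interval)
  then obtain c where c: "f b < c" "c < f a" "c \<notin> f ` S"
    using S countable_subset[of "{f b<..<f a}" "f ` S"]
    by (metis countable_image greaterThanLessThan_iff subsetI)
  define K where "K = {a..b} \<inter> f -` {c}"
  have "closed K"
    unfolding K_def by (rule continuous_closed_preimage[OF cont]) auto
  have bdd: "bdd_above K" unfolding K_def by (rule bdd_aboveI[of _ b]) auto
  have ne: "K \<noteq> {}"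
    using IVT2'[of f b c a] c ab cont by (force simp: K_def)
  define x where "x = Sup K"
  have xK: "x \<in> K"
    unfolding x_def by (rule closed_contains_Sup[OF ne bdd \<open>closed K\<close>])
  then have fx: "f x = c" and "a \<le> x" "x \<le> b" by (auto simp: K_def)
  moreover have "x \<noteq> a" "x \<noteq> b" using fx c by auto
  ultimately have x: "a < x" "x < b" by auto
  have "x \<notin> S" using fx c by auto
  then obtain y where "y > 0" "(f has_real_derivative y) (at x)"
    using der x by blast
  then obtain d where d: "d > 0" "\<And>h. h > 0 \<Longrightarrow> h < d \<Longrightarrow> f x < f (x + h)"
    using DERIV_pos_inc_right by blast
  define z where "z = x + min (d/2) ((b - x)/2)"
  have z: "x < z" "z < b" "f x < f z"
    using x d(1) d(2)[of "min (d/2) ((b - x)/2)"] by (auto simp: z_def min_def field_simps)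
  have "continuous_on {z..b} f"
    using cont by (rule continuous_on_subset) (use z x in auto)
  then obtain w where "z \<le> w" "w \<le> b" "f w = c"
    using IVT2'[of f b c z] c z fx by auto
  then have "w \<in> K" using z x by (auto simp: K_def)
  then have "w \<le> x" unfolding x_def using bdd by (rule cSup_upper)
  then show False using \<open>z \<le> w\<close> z by simp
qed

text \<open>Adding \<open>k x\<close> with a small \<open>k > 0\<close> makes the derivative positive; the same applies to \<open>- f\<close>.\<close>

lemma const_of_zero_deriv_off_countable:
  fixes f :: "real \<Rightarrow> real"
  assumes ab: "a \<le> b" and cont: "continuous_on {a..b} f" and S: "countable S"
    and der: "\<And>x. a < x \<Longrightarrow> x < b \<Longrightarrow> x \<notin> S \<Longrightarrow> (f has_real_derivative 0) (at x)"
  shows "f a = f b"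
proof -
  have *: "g a \<le> g b" if g: "continuous_on {a..b} g"
     "\<And>x. a < x \<Longrightarrow> x < b \<Longrightarrow> x \<notin> S \<Longrightarrow> (g has_real_derivative 0) (at x)" for g :: "real \<Rightarrow> real"
  proof (rule field_le_epsilon)
    fix e :: real assume "e > 0"
    \<comment> \<open>the summand \<open>1\<close> covers the case \<open>a = b\<close>\<close>
    define k where "k = e / (b - a + 1)"
    have k: "k > 0" "k * (b - a) \<le> e" using \<open>e > 0\<close> ab by (auto simp: k_def field_simps)
    have "g a + k * a \<le> g b + k * b"
    proof (rule nondecreasing_of_pos_deriv_off_countable[where f="\<lambda>x. g x + k * x", OF ab _ S])
      show "continuous_on {a..b} (\<lambda>x. g x + k * x)" by (intro continuous_intros g)
      fix x assume "a < x" "x < b" "x \<notin> S"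
      then have "((\<lambda>x. g x + k * x) has_real_derivative k) (at x)"
        by (auto intro!: derivative_eq_intros g)
      then show "\<exists>y>0. ((\<lambda>x. g x + k * x) has_real_derivative y) (at x)" using k by blast
    qed
    then show "g a \<le> g b + e" using k by (simp add: algebra_simps)
  qed
  have "f a \<le> f b" by (rule *) (use cont der in auto)
  moreover have "- f a \<le> - f b"
    by (rule *[where g="\<lambda>x. - f x"]) (use cont der in \<open>auto intro!: continuous_intros derivative_eq_intros\<close>)
  ultimately show ?thesis by simp
qed

lemma LBINT_point: "(LBINT w:{a..a}. h w) = 0" for h :: "real \<Rightarrow> real"
proof -
  have "(LBINT w:{a..a}. h w) = (LBINT w:{a..a}. h a)" by (rule set_lebesgue_integral_cong) auto
  then show ?thesis by (simp add: set_integral_const)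
qed

lemma LBINT_indefinite:
  fixes h :: "real \<Rightarrow> real"
  assumes h: "set_integrable lborel {a..b} h"
  shows continuous_on_LBINT: "continuous_on {a..b} (\<lambda>x. LBINT w:{a..x}. h w)"
    and has_real_derivative_LBINT: "a < z \<Longrightarrow> z < b \<Longrightarrow> isCont h z \<Longrightarrow>
      ((\<lambda>x. LBINT w:{a..x}. h w) has_real_derivative h z) (at z)"
proof -
  have eq: "(LBINT w:{a..x}. h w) = integral {a..x} h" if "x \<in> {a..b}" for x
    by (rule set_borel_integral_eq_integral, rule set_integrable_subset[OF h]) (use that in auto)
  have int: "h integrable_on {a..b}" by (rule set_borel_integral_eq_integral[OF h])
  have "continuous_on {a..b} (\<lambda>x. integral {a..x} h)"
    by (rule indefinite_integral_continuous_1[OF int])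
  then show "continuous_on {a..b} (\<lambda>x. LBINT w:{a..x}. h w)"
    by (rule continuous_on_cong[THEN iffD1, rotated 2]) (use eq in auto)
  assume z: "a < z" "z < b" "isCont h z"
  have "((\<lambda>u. integral {a..u} h) has_vector_derivative h z) (at z within {a..b} - {})"
    by (rule integral_has_vector_derivative_continuous_at[OF int])
       (use z continuous_at_imp_continuous_at_within in auto)
  then have "((\<lambda>u. integral {a..u} h) has_real_derivative h z) (at z)"
    using z at_within_Icc_at[of a z b] by (simp add: has_real_derivative_iff_has_vector_derivative)
  then show "((\<lambda>x. LBINT w:{a..x}. h w) has_real_derivative h z) (at z)"
    by (rule has_field_derivative_transform_within_open[where S="{a<..<b}"]) (use z eq in auto)
qed

text \<open>Continuity of \<open>h\<close> off the exceptional set makes its indefinite integral differentiable there, with the same derivative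
as \<open>f\<close>.\<close>

lemma LBINT_FTC_off_countable:
  fixes f h :: "real \<Rightarrow> real"
  assumes ab: "a \<le> b" and cont: "continuous_on {a..b} f" and S: "countable S"
    and h: "set_integrable lborel {a..b} h"
    and der: "\<And>x. a < x \<Longrightarrow> x < b \<Longrightarrow> x \<notin> S \<Longrightarrow> (f has_real_derivative h x) (at x)"
    and hc: "\<And>x. a < x \<Longrightarrow> x < b \<Longrightarrow> x \<notin> S \<Longrightarrow> isCont h x"
  shows "(LBINT x:{a..b}. h x) = f b - f a"
proof -
  let ?H = "\<lambda>x. LBINT w:{a..x}. h w"
  have "f a - ?H a = f b - ?H b"
  proof (rule const_of_zero_deriv_off_countable[where f="\<lambda>x. f x - ?H x", OF ab _ S])
    show "continuous_on {a..b} (\<lambda>x. f x - ?H x)"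
      by (intro continuous_intros cont continuous_on_LBINT h)
    fix x assume x: "a < x" "x < b" "x \<notin> S"
    show "((\<lambda>x. f x - ?H x) has_real_derivative 0) (at x)"
      using DERIV_diff[OF der[OF x] has_real_derivative_LBINT[OF h x(1,2) hc[OF x]]] by simp
  qed
  moreover have "?H a = 0" by (subst set_borel_integral_eq_integral(2)[OF set_integrable_subset[OF h]]) (use ab in auto)
  ultimately show ?thesis by simp
qed

lemma set_integrable_bounded_Icc:
  fixes h :: "real \<Rightarrow> real"
  assumes "h \<in> borel_measurable borel" "\<And>x. a \<le> x \<Longrightarrow> x \<le> b \<Longrightarrow> \<bar>h x\<bar> \<le> B"
  shows "set_integrable lborel {a..b} h"
  unfolding set_integrable_def
  by (rule integrableI_bounded_set_indicator[where B=B]) (use assms in \<open>auto simp: emeasure_lborel_Icc_eq\<close>)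

section \<open>The function \<open>\<phi>\<close>\<close>

locale offer_distribution = real_distribution N for N :: "real measure" +
  fixes mu0 :: real
  assumes pos_part_integrable: "integrable N (\<lambda>x. max x 0)"
    and mu0_less_upper_end: "ereal mu0 < upper_end (cdf N)"
begin

abbreviation F :: "real \<Rightarrow> real" where "F \<equiv> cdf N"
abbreviation \<phi> :: "real \<Rightarrow> real" where "\<phi> \<equiv> phi F"

lemma F_measurable [measurable]: "F \<in> borel_measurable borel"
  by (rule borel_measurable_mono) (simp add: mono_def cdf_nondecreasing)

lemma tail_eq: "1 - F u = measure N {u<..}"
proof -
  have "measure N {u<..} = measure N (space N - {..u})" by (rule arg_cong[of _ _ "measure N"]) auto
  also have "\<dots> = 1 - F u" by (subst prob_compl) (auto simp: cdf_def2)
  finally show ?thesis ..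
qed

text \<open>By Tonelli, the integral of the tail over \<open>[x, \<infinity>)\<close> is the expectation of \<open>(X - x)\<^sub>+\<close>.\<close>

lemma tail_integrable: "set_integrable lborel {x..} (\<lambda>u. 1 - F u)"
proof -
  interpret pair_sigma_finite N lborel by unfold_locales
  have "(\<integral>\<^sup>+u. ennreal (indicator {x..} u * (1 - F u)) \<partial>lborel)
      = (\<integral>\<^sup>+u. (\<integral>\<^sup>+z. indicator {x..} u * indicator {u<..} z \<partial>N) \<partial>lborel)"
    by (intro nn_integral_cong)
       (simp add: tail_eq nn_integral_cmult emeasure_eq_measure ennreal_mult ennreal_indicator)
  also have "\<dots> = (\<integral>\<^sup>+z. (\<integral>\<^sup>+u. indicator {x..} u * indicator {u<..} z \<partial>lborel) \<partial>N)"
    by (rule Fubini')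
       (simp add: indicator_def, measurable)
  also have "\<dots> \<le> (\<integral>\<^sup>+z. ennreal (max z 0 + \<bar>x\<bar>) \<partial>N)"
  proof (rule nn_integral_mono)
    fix z
    have "(\<integral>\<^sup>+u. indicator {x..} u * indicator {u<..} z \<partial>lborel) = (\<integral>\<^sup>+u. indicator {x..<z} u \<partial>lborel)"
      by (intro nn_integral_cong) (auto simp: indicator_def)
    also have "\<dots> = emeasure lborel {x..<z}" by simp
    also have "\<dots> \<le> ennreal (max z 0 + \<bar>x\<bar>)" by (cases "x \<le> z") (simp_all add: ennreal_leI del: ennreal_plus)
    finally show "(\<integral>\<^sup>+u. indicator {x..} u * indicator {u<..} z \<partial>lborel) \<le> ennreal (max z 0 + \<bar>x\<bar>)" .
  qed
  also have "\<dots> < \<infinity>"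
  proof -
    have "integrable N (\<lambda>z. max z 0 + \<bar>x\<bar>)" by (intro Bochner_Integration.integrable_add pos_part_integrable) simp
    then show ?thesis
      using nn_integral_eq_integral[of N "\<lambda>z. max z 0 + \<bar>x\<bar>"] by simp
  qed
  finally show ?thesis
    unfolding set_integrable_def
    by (intro integrableI_nonneg) (auto simp: cdf_bounded_prob indicator_def)
qed

lemma tail_integrable_Icc: "set_integrable lborel {x..y} (\<lambda>u. 1 - F u)"
  by (rule set_integrable_subset[OF tail_integrable[of x]]) auto

lemma phi_split: "x \<le> y \<Longrightarrow> \<phi> x = (LBINT u:{x..y}. 1 - F u) + \<phi> y"
proof -
  assume "x \<le> y"
  have "{x..} = {x..<y} \<union> {y..}" using \<open>x \<le> y\<close> by auto
  then have "\<phi> x = (LBINT u:{x..<y} \<union> {y..}. 1 - F u)"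
    by (simp add: phi_def)
  also have "\<dots> = (LBINT u:{x..<y}. 1 - F u) + \<phi> y" unfolding phi_def
    by (rule set_integral_Un) (auto intro: set_integrable_subset[OF tail_integrable[of x]] tail_integrable)
  also have "(LBINT u:{x..<y}. 1 - F u) = (LBINT u:{x..y}. 1 - F u)"
    unfolding set_lebesgue_integral_def
    by (rule integral_cong_AE) (auto intro!: AE_I'[where N="{y}"] simp: indicator_def split: if_splits)
  finally show ?thesis .
qed

lemma phi_antimono: "x \<le> y \<Longrightarrow> \<phi> y \<le> \<phi> x"
  using phi_split[of x y] cdf_bounded_prob
  by (auto simp: set_lebesgue_integral_def indicator_def intro!: Bochner_Integration.integral_nonneg)

lemma phi_nonneg: "0 \<le> \<phi> x"
  unfolding phi_def set_lebesgue_integral_def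
  by (intro Bochner_Integration.integral_nonneg) (simp add: cdf_bounded_prob)

lemma phi_measurable [measurable]: "\<phi> \<in> borel_measurable borel"
proof -
  have "mono (\<lambda>x. - \<phi> x)" by (auto simp: mono_def phi_antimono)
  then have "(\<lambda>x. - (- \<phi> x)) \<in> borel_measurable borel"
    by (intro borel_measurable_uminus borel_measurable_mono)
  then show ?thesis by simp
qed

lemma phi_ge: "x \<le> z \<Longrightarrow> (z - x) * (1 - F z) \<le> \<phi> x"
proof -
  assume xz: "x \<le> z"
  have "(z - x) * (1 - F z) = (LBINT u:{x..z}. 1 - F z)" using xz by (simp add: set_integral_const)
  also have "\<dots> \<le> (LBINT u:{x..z}. 1 - F u)"
    by (rule set_integral_mono[OF _ tail_integrable_Icc])
       (auto intro: set_integrable_bounded_Icc cdf_nondecreasing)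
  also have "\<dots> \<le> \<phi> x" using phi_split[OF xz] phi_nonneg[of z] by simp
  finally show ?thesis .
qed

text \<open>Some \<open>z > x\<close> still has \<open>F z < 1\<close>, and the tail is at least \<open>1 - F z\<close> on all of \<open>[x, z]\<close>.\<close>

lemma phi_pos:
  assumes "ereal x < upper_end F" shows "0 < \<phi> x"
proof -
  obtain z where z: "x < z" "F z < 1"
    using assms by (auto simp: upper_end_def less_Sup_iff)
  then have "0 < (z - x) * (1 - F z)" by simp
  also have "\<dots> \<le> \<phi> x" using z by (intro phi_ge) simp
  finally show ?thesis .
qed

text \<open>For a finite upper end \<open>M\<close> this makes \<open>1/\<phi>\<close> non-integrable at \<open>M\<close>, so that the policy is defined for all times.\<close>

lemma phi_le_dist_upper_end:
  assumes M: "upper_end F = ereal M" and x: "x \<le> M" shows "\<phi> x \<le> M - x"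
proof -
  have F1: "F u = 1" if "M < u" for u
  proof (rule ccontr)
    assume "F u \<noteq> 1"
    then have "F u < 1" using cdf_bounded_prob[of u] by simp
    then have "ereal u \<le> upper_end F" unfolding upper_end_def by (intro Sup_upper) auto
    then show False using M that by simp
  qed
  have "\<phi> M = (LBINT u:{M..}. 0)" unfolding phi_def
    unfolding set_lebesgue_integral_def
    by (rule integral_cong_AE) (auto intro!: AE_I'[where N="{M}"] F1 simp: indicator_def order_le_less split: if_splits)
  then have "\<phi> M = 0" by (simp add: set_lebesgue_integral_def)
  moreover have "(LBINT u:{x..M}. 1 - F u) \<le> (LBINT u:{x..M}. 1)"
    by (rule set_integral_mono[OF tail_integrable_Icc])
       (auto intro: set_integrable_bounded_Icc simp: cdf_nonneg)
  ultimately show ?thesis using phi_split[OF x] x by (simp add: set_integral_const)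
qed

lemma phi_isCont: "isCont \<phi> x"
proof -
  have "continuous_on {x-1..x+1} (\<lambda>y. \<phi> (x-1) - (LBINT u:{x-1..y}. 1 - F u))"
    by (intro continuous_intros continuous_on_LBINT tail_integrable_Icc)
  then have "continuous_on {x-1..x+1} \<phi>"
    by (rule continuous_on_cong[THEN iffD1, rotated 2]) (use phi_split[of "x-1"] in \<open>auto simp: algebra_simps\<close>)
  then show ?thesis by (rule continuous_on_interior) auto
qed

lemma phi_has_derivative:
  assumes "isCont F x" shows "(\<phi> has_real_derivative (F x - 1)) (at x)"
proof -
  have "((\<lambda>y. \<phi> (x-1) - (LBINT u:{x-1..y}. 1 - F u)) has_real_derivative 0 - (1 - F x)) (at x)"
    by (intro derivative_intros has_real_derivative_LBINT[OF tail_integrable_Icc[of "x-1" "x+1"]])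
       (use assms in \<open>auto intro!: continuous_intros\<close>)
  then have "((\<lambda>y. \<phi> (x-1) - (LBINT u:{x-1..y}. 1 - F u)) has_real_derivative F x - 1) (at x)" by simp
  then show ?thesis
    by (rule has_field_derivative_transform_within_open[where S="{x-1<..<x+1}"])
       (use phi_split[of "x-1"] in \<open>auto simp: algebra_simps\<close>)
qed

section \<open>Integrals with weights \<open>1/\<phi>\<^sup>k\<close>\<close>

abbreviation price_range :: "real set" where
  "price_range \<equiv> {x. mu0 \<le> x \<and> ereal x < upper_end F}"

lemma price_range_below: "b \<in> price_range \<Longrightarrow> mu0 \<le> x \<Longrightarrow> x \<le> b \<Longrightarrow> x \<in> price_range"
  by (auto intro: le_less_trans[of _ "ereal b"])

lemma price_range_extend:
  assumes "x \<in> price_range" obtains b where "x < b" "b \<in> price_range"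
proof -
  obtain b where "ereal x < ereal b" "ereal b < upper_end F"
    using assms ereal_dense2[of "ereal x" "upper_end F"] by auto
  then show ?thesis using that[of b] assms by auto
qed

lemma mu0_in_range: "mu0 \<in> price_range"
  using mu0_less_upper_end by simp

lemma phi_pos_range: "x \<in> price_range \<Longrightarrow> 0 < \<phi> x"
  by (auto intro: phi_pos)

text \<open>On \<open>[mu0, b]\<close> the decreasing function \<open>\<phi>\<close> is bounded below by \<open>\<phi> b > 0\<close>.\<close>

lemma weight_integrable:
  fixes h :: "real \<Rightarrow> real"
  assumes h [measurable]: "h \<in> borel_measurable borel" and B: "\<And>w. \<bar>h w\<bar> \<le> B"
    and b: "b \<in> price_range"
  shows "set_integrable lborel {mu0..b} (\<lambda>w. h w / \<phi> w ^ k)"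
proof (rule set_integrable_bounded_Icc[where B="B / \<phi> b ^ k"])
  fix w assume "mu0 \<le> w" "w \<le> b"
  then have "\<phi> b \<le> \<phi> w" "0 < \<phi> b" using b by (auto intro: phi_antimono phi_pos)
  then have "\<phi> b ^ k \<le> \<phi> w ^ k" "0 < \<phi> b ^ k" "0 < \<phi> w ^ k" by (auto intro: power_mono)
  then show "\<bar>h w / \<phi> w ^ k\<bar> \<le> B / \<phi> b ^ k"
    using B[of w] by (auto simp: abs_divide intro!: frac_le)
qed measurable

lemma countable_discontinuities_F: "countable {x. \<not> isCont F x}"
  using countable_atoms by (simp add: isCont_cdf zero_less_measure_iff)

lemma isCont_weight: "isCont h w \<Longrightarrow> w \<in> price_range \<Longrightarrow> isCont (\<lambda>w. h w / \<phi> w ^ k) w"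
  using phi_pos_range[of w] by (auto intro!: continuous_intros phi_isCont)

text \<open>At continuity points of \<open>F\<close>, \<open>(1/\<phi>)' = - \<phi>'/\<phi>\<^sup>2 = (1 - F)/\<phi>\<^sup>2\<close>.\<close>

lemma reciprocal_phi_integral:
  assumes z: "z \<in> price_range"
  shows "(LBINT w:{mu0..z}. (1 - F w) / (\<phi> w)\<^sup>2) = 1 / \<phi> z - 1 / \<phi> mu0"
proof (rule LBINT_FTC_off_countable[OF _ _ countable_discontinuities_F])
  show "mu0 \<le> z" using z by simp
  have rng: "w \<in> price_range" if "mu0 \<le> w" "w \<le> z" for w using price_range_below[OF z that] .
  show "continuous_on {mu0..z} (\<lambda>w. 1 / \<phi> w)"
  proof (rule continuous_at_imp_continuous_on, rule ballI)
    fix w assume "w \<in> {mu0..z}"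
    then have "\<phi> w \<noteq> 0" using phi_pos_range[OF rng[of w]] by simp
    then show "isCont (\<lambda>w. 1 / \<phi> w) w" by (intro continuous_intros phi_isCont)
  qed
  show "set_integrable lborel {mu0..z} (\<lambda>w. (1 - F w) / (\<phi> w)\<^sup>2)"
    by (rule weight_integrable[where B=1, OF _ _ z]) (auto simp: cdf_bounded_prob cdf_nonneg)
  fix w assume w: "mu0 < w" "w < z" "w \<notin> {x. \<not> isCont F x}"
  then have [simp]: "\<phi> w \<noteq> 0" using phi_pos_range[OF rng[of w]] by simp
  show "((\<lambda>w. 1 / \<phi> w) has_real_derivative (1 - F w) / (\<phi> w)\<^sup>2) (at w)"
    using w by (auto intro!: derivative_eq_intros phi_has_derivative simp: power2_eq_square field_simps)
  show "isCont (\<lambda>w. (1 - F w) / (\<phi> w)\<^sup>2) w"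
    using w by (intro isCont_weight rng continuous_intros) auto
qed

text \<open>The positive part cuts the integral off at \<open>w = x\<close>, because \<open>F\<close> is monotone.  On the rest, write
\<open>F x - F w = (1 - F w) + (F x - 1)\<close>; the first summand has the antiderivative \<open>1/\<phi>\<close>.\<close>

lemma excess_integral_cases:
  assumes z: "z \<in> price_range"
  shows "(LBINT w:{mu0..z}. max (F x - F w) 0 / (\<phi> w)\<^sup>2) =
    (if x < mu0 then 0
     else if x < z then
       1 / \<phi> x - 1 / \<phi> mu0 + phi_deriv F x * (LBINT w:{mu0..x}. 1 / (\<phi> w)\<^sup>2)
     else
       1 / \<phi> z - 1 / \<phi> mu0 + phi_deriv F x * (LBINT w:{mu0..z}. 1 / (\<phi> w)\<^sup>2))"
proof -
  have full: "(LBINT w:{mu0..b}. (F x - F w) / (\<phi> w)\<^sup>2) =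
      1 / \<phi> b - 1 / \<phi> mu0 + phi_deriv F x * (LBINT w:{mu0..b}. 1 / (\<phi> w)\<^sup>2)"
    if b: "b \<in> price_range" for b
  proof -
    have "(LBINT w:{mu0..b}. (F x - F w) / (\<phi> w)\<^sup>2) =
        (LBINT w:{mu0..b}. (1 - F w) / (\<phi> w)\<^sup>2 + phi_deriv F x * (1 / (\<phi> w)\<^sup>2))"
      by (rule set_lebesgue_integral_cong) (auto simp: phi_deriv_def diff_divide_distrib add_divide_distrib[symmetric])
    also have "\<dots> = (LBINT w:{mu0..b}. (1 - F w) / (\<phi> w)\<^sup>2) + (LBINT w:{mu0..b}. phi_deriv F x * (1 / (\<phi> w)\<^sup>2))"
      by (intro set_integral_add(2) set_integrable_mult_right weight_integrable[where B=1] b)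
         (auto simp: cdf_bounded_prob cdf_nonneg)
    finally show ?thesis by (simp only: reciprocal_phi_integral[OF b] set_integral_mult_right)
  qed
  show ?thesis
  proof (cases "x < mu0")
    case True
    then have "(LBINT w:{mu0..z}. max (F x - F w) 0 / (\<phi> w)\<^sup>2) = (LBINT w:{mu0..z}. 0)"
      by (intro set_lebesgue_integral_cong) (auto simp: max_def cdf_nondecreasing)
    then show ?thesis using True by (simp add: set_lebesgue_integral_def)
  next
    case False
    have pos: "max (F x - F w) 0 = (if w \<le> x then F x - F w else 0)" for w
      using cdf_nondecreasing[of w x] cdf_nondecreasing[of x w] by auto
    have "(LBINT w:{mu0..z}. max (F x - F w) 0 / (\<phi> w)\<^sup>2)
        = (LBINT w:{mu0..min x z}. (F x - F w) / (\<phi> w)\<^sup>2)"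
      unfolding set_lebesgue_integral_def
      by (intro Bochner_Integration.integral_cong) (auto simp: indicator_def pos)
    moreover have "min x z \<in> price_range"
      using False z by (intro price_range_below[OF z]) auto
    ultimately show ?thesis using False full[of "min x z"] by (cases "x < z") simp_all
  qed
qed

section \<open>The function \<open>\<Psi>\<close> and the optimal policy\<close>

lemma Psi_mu0: "Psi F mu0 mu0 = 0"
  unfolding Psi_def by (rule LBINT_point)

lemma Psi_continuous: "b \<in> price_range \<Longrightarrow> continuous_on {mu0..b} (Psi F mu0)"
  unfolding Psi_def
  using weight_integrable[of "\<lambda>_. 1" 1 b 1] by (intro continuous_on_LBINT) auto

lemma Psi_has_derivative:
  assumes x: "x \<in> price_range" "mu0 < x"
  shows "(Psi F mu0 has_real_derivative 1 / \<phi> x) (at x)"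
proof -
  obtain b where b: "x < b" "b \<in> price_range" using price_range_extend[OF x(1)] .
  show ?thesis
    unfolding Psi_def using isCont_weight[of x "\<lambda>_. 1" 1] weight_integrable[of "\<lambda>_. 1" 1 b 1] b x
    by (intro has_real_derivative_LBINT[where b=b]) auto
qed

text \<open>As \<open>\<Psi>' = 1/\<phi> \<ge> 1/\<phi> mu0\<close>.  This gives injectivity of \<open>\<Psi>\<close>, its divergence when the price range is
unbounded, and the Lipschitz continuity of its inverse.\<close>

lemma Psi_expanding:
  assumes y: "y \<in> price_range" and x: "mu0 \<le> x" "x \<le> y"
  shows "(y - x) / \<phi> mu0 \<le> Psi F mu0 y - Psi F mu0 x"
proof -
  have "Psi F mu0 x - x / \<phi> mu0 \<le> Psi F mu0 y - y / \<phi> mu0"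
  proof (rule DERIV_nonneg_imp_increasing_open[OF x(2)])
    show "continuous_on {x..y} (\<lambda>u. Psi F mu0 u - u / \<phi> mu0)"
      using phi_pos_range[OF mu0_in_range]
      by (intro continuous_intros continuous_on_subset[OF Psi_continuous[OF y]]) (use x in auto)
    fix u assume u: "x < u" "u < y"
    have ur: "u \<in> price_range" using price_range_below[OF y, of u] u x by simp
    have "((\<lambda>u. Psi F mu0 u - u / \<phi> mu0) has_real_derivative 1 / \<phi> u - 1 / \<phi> mu0) (at u)"
      using u x by (intro derivative_intros Psi_has_derivative ur DERIV_cdivide) auto
    moreover have "1 / \<phi> mu0 \<le> 1 / \<phi> u"
      using u x phi_pos_range[OF ur] by (intro frac_le phi_antimono) auto
    ultimately show "\<exists>d. ((\<lambda>u. Psi F mu0 u - u / \<phi> mu0) has_real_derivative d) (at u) \<and> 0 \<le> d"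
      by (intro exI[of _ "1 / \<phi> u - 1 / \<phi> mu0"]) simp
  qed
  then show ?thesis by (simp add: diff_divide_distrib)
qed

lemma Psi_strict_mono: "y \<in> price_range \<Longrightarrow> mu0 \<le> x \<Longrightarrow> x < y \<Longrightarrow> Psi F mu0 x < Psi F mu0 y"
  using Psi_expanding[of y x] phi_pos_range[OF mu0_in_range]
  by (smt (verit) divide_pos_pos)

text \<open>If the upper end is infinite, \<open>\<Psi>\<close> grows at least linearly.  If it is a real \<open>M\<close>, then \<open>\<Psi>' = 1/\<phi> \<ge> 1/(M - x)\<close>,
so \<open>\<Psi>\<close> grows at least like \<open>- ln (M - x)\<close>.\<close>

lemma Psi_unbounded: "\<exists>x\<in>price_range. T \<le> Psi F mu0 x"
proof (cases "T \<le> 0")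
  case True then show ?thesis using mu0_in_range Psi_mu0 by auto
next
  case False
  show ?thesis
  proof (cases "upper_end F")
    case PInf
    have "mu0 + T * \<phi> mu0 \<in> price_range" using False PInf phi_nonneg[of mu0] by simp
    moreover have "T \<le> Psi F mu0 (mu0 + T * \<phi> mu0)"
      using Psi_expanding[OF calculation, of mu0] False phi_pos_range[OF mu0_in_range]
      by (simp add: Psi_mu0)
    ultimately show ?thesis by blast
  next
    case (real M)
    \<comment> \<open>the solution of \<open>ln (M - mu0) - ln (M - x) = T\<close>\<close>
    define x where "x = M - (M - mu0) * exp (- T)"
    have M: "mu0 < M" using mu0_less_upper_end real by simp
    have "(M - mu0) * exp (- T) \<le> (M - mu0) * 1" using False M by (intro mult_left_mono) auto
    moreover have "0 < (M - mu0) * exp (- T)" using M by simp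
    ultimately have x: "mu0 \<le> x" "x < M" unfolding x_def by simp_all
    then have xr: "x \<in> price_range" using real by simp
    have "Psi F mu0 mu0 + ln (M - mu0) \<le> Psi F mu0 x + ln (M - x)"
    proof (rule DERIV_nonneg_imp_increasing_open[OF x(1)])
      show "continuous_on {mu0..x} (\<lambda>u. Psi F mu0 u + ln (M - u))"
        by (intro continuous_intros Psi_continuous xr) (use x in auto)
      fix u assume u: "mu0 < u" "u < x"
      have ur: "u \<in> price_range" using price_range_below[OF xr, of u] u by simp
      have "((\<lambda>u. Psi F mu0 u + ln (M - u)) has_real_derivative 1 / \<phi> u - 1 / (M - u)) (at u)"
        using u x by (auto intro!: derivative_eq_intros Psi_has_derivative ur)
      moreover have "1 / (M - u) \<le> 1 / \<phi> u"
        using u x phi_pos_range[OF ur] phi_le_dist_upper_end[OF real, of u] by (intro frac_le) auto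
      ultimately show "\<exists>d. ((\<lambda>u. Psi F mu0 u + ln (M - u)) has_real_derivative d) (at u) \<and> 0 \<le> d"
        by (intro exI[of _ "1 / \<phi> u - 1 / (M - u)"]) simp
    qed
    moreover have "ln (M - x) = ln (M - mu0) - T"
      using M by (simp add: x_def ln_mult)
    ultimately have "T \<le> Psi F mu0 x" by (simp add: Psi_mu0)
    then show ?thesis using xr by blast
  next
    case MInf then show ?thesis using mu0_less_upper_end by simp
  qed
qed

lemma Psi_surj: assumes "0 \<le> T" shows "\<exists>x\<in>price_range. Psi F mu0 x = T"
proof -
  obtain b where b: "b \<in> price_range" "T \<le> Psi F mu0 b" using Psi_unbounded by blast
  obtain x where "mu0 \<le> x" "x \<le> b" "Psi F mu0 x = T"
    using IVT'[of "Psi F mu0" mu0 T b] b assms Psi_continuous[OF b(1)] by (auto simp: Psi_mu0)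
  then show ?thesis using price_range_below[OF b(1)] by blast
qed

lemma Psi_inj_on: "inj_on (Psi F mu0) price_range"
proof (rule linorder_inj_onI')
  fix x y assume "x \<in> price_range" "y \<in> price_range" "x < y"
  then show "Psi F mu0 x \<noteq> Psi F mu0 y" using Psi_strict_mono[of y x] by simp
qed

end

locale optimal_pricing = offer_distribution +
  fixes lam :: real
  assumes lam_pos: "0 < lam"
begin

text \<open>Extending the policy by its value at time \<open>0\<close> to negative times makes it monotone and continuous, hence Borel, on the
whole line.\<close>

definition policy :: "real \<Rightarrow> real" where
  "policy s = optimal_policy lam F mu0 (max s 0)"

lemma policy_in_range: "policy s \<in> price_range"
  and Psi_policy: "Psi F mu0 (policy s) = lam * max s 0"
proof -
  have "lam * max s 0 \<in> Psi F mu0 ` price_range"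
    using Psi_surj[of "lam * max s 0"] lam_pos by force
  then show "policy s \<in> price_range" "Psi F mu0 (policy s) = lam * max s 0"
    unfolding policy_def optimal_policy_def
    using the_inv_into_into[OF Psi_inj_on _ order_refl] f_the_inv_into_f[OF Psi_inj_on] by blast+
qed

lemma policy_ge: "mu0 \<le> policy s" and phi_policy_pos: "0 < \<phi> (policy s)"
  using policy_in_range[of s] phi_pos_range by auto

lemma policy_0: "policy 0 = mu0"
  using Psi_policy[of 0] policy_in_range[of 0] mu0_in_range Psi_inj_on
  by (auto simp: Psi_mu0 inj_on_def)

lemma policy_strict_mono: "0 \<le> s \<Longrightarrow> s < r \<Longrightarrow> policy s < policy r"
proof (rule ccontr)
  assume sr: "0 \<le> s" "s < r" and "\<not> policy s < policy r"
  then have "Psi F mu0 (policy r) \<le> Psi F mu0 (policy s)"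
    using Psi_strict_mono[OF policy_in_range[of s] policy_ge[of r]] by (cases "policy r = policy s") auto
  then show False using sr lam_pos by (simp add: Psi_policy)
qed

lemma policy_mono: "s \<le> r \<Longrightarrow> policy s \<le> policy r"
proof -
  assume "s \<le> r"
  have e: "policy s = policy (max s 0)" "policy r = policy (max r 0)" by (auto simp: policy_def)
  show ?thesis unfolding e using \<open>s \<le> r\<close> policy_strict_mono[of "max s 0" "max r 0"]
    by (cases "max s 0 = max r 0") (simp, linarith)
qed

lemma policy_lipschitz:
  assumes "s \<le> r" shows "policy r - policy s \<le> \<phi> mu0 * lam * (r - s)"
proof -
  have p: "0 < \<phi> mu0" by (rule phi_pos_range[OF mu0_in_range])
  have "(policy r - policy s) / \<phi> mu0 \<le> lam * max r 0 - lam * max s 0"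
    using Psi_expanding[OF policy_in_range[of r] policy_ge[of s] policy_mono[OF assms]] by (simp add: Psi_policy)
  also have "\<dots> \<le> lam * (r - s)"
    unfolding right_diff_distrib[symmetric] using assms lam_pos by (intro mult_left_mono) auto
  finally show ?thesis using p by (simp add: field_simps)
qed

lemma policy_isCont: "isCont policy s"
proof -
  let ?C = "\<phi> mu0 * lam"
  have bd: "\<bar>policy r - policy s\<bar> \<le> ?C * \<bar>r - s\<bar>" for r
    using policy_lipschitz[of r s] policy_lipschitz[of s r] policy_mono[of r s] policy_mono[of s r]
    by (cases "r \<le> s") auto
  have "((\<lambda>r. policy r - policy s) \<longlongrightarrow> 0) (at s)"
  proof (rule Lim_null_comparison)
    show "\<forall>\<^sub>F r in at s. norm (policy r - policy s) \<le> ?C * \<bar>r - s\<bar>" using bd by simp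
    have "((\<lambda>r. ?C * \<bar>r - s\<bar>) \<longlongrightarrow> ?C * \<bar>s - s\<bar>) (at s)" by (intro tendsto_intros)
    then show "((\<lambda>r. ?C * \<bar>r - s\<bar>) \<longlongrightarrow> 0) (at s)" by simp
  qed
  then show ?thesis unfolding isCont_def by (simp add: LIM_zero_iff)
qed

lemma policy_measurable [measurable]: "policy \<in> borel_measurable borel"
  by (rule borel_measurable_mono) (simp add: mono_def policy_mono)

text \<open>The differential equation of the policy, from \<open>\<Psi> (\<mu> s) = \<lambda> s\<close> and \<open>\<Psi>' = 1/\<phi>\<close>.\<close>

lemma policy_has_derivative:
  assumes "0 < s" shows "(policy has_real_derivative lam * \<phi> (policy s)) (at s)"
proof -
  have p: "0 < \<phi> (policy s)" by (rule phi_policy_pos)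
  have "policy s > mu0" using policy_strict_mono[of 0 s] assms by (simp add: policy_0)
  then have "(Psi F mu0 has_real_derivative 1 / \<phi> (policy s)) (at (policy s))"
    by (rule Psi_has_derivative[OF policy_in_range])
  then have "((\<lambda>u. Psi F mu0 u / lam) has_real_derivative 1 / \<phi> (policy s) / lam) (at (policy s))"
    by (rule DERIV_cdivide)
  then have "(policy has_real_derivative inverse (1 / \<phi> (policy s) / lam)) (at s)"
    by (rule DERIV_inverse_function[where a=0 and b="s+1"])
       (use assms p lam_pos policy_isCont in \<open>auto simp: Psi_policy\<close>)
  then show ?thesis using p lam_pos by (simp add: field_simps)
qed

text \<open>The policy is injective on \<open>[0, \<infinity>)\<close> and \<open>F\<close> has countably many jumps.\<close>

lemma countable_policy_discontinuities: "countable {s. 0 \<le> s \<and> \<not> isCont F (policy s)}"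
proof (rule countable_image_inj_on[where f=policy])
  show "countable (policy ` {s. 0 \<le> s \<and> \<not> isCont F (policy s)})"
    by (rule countable_subset[OF _ countable_discontinuities_F]) auto
  show "inj_on policy {s. 0 \<le> s \<and> \<not> isCont F (policy s)}"
    by (rule linorder_inj_onI') (auto dest: policy_strict_mono)
qed

section \<open>The renewal equation of the price distribution\<close>

text \<open>The closed form for the probability of a price at most \<open>x\<close> when the remaining time is \<open>s\<close>; \<open>c\<close> is the
probability that the residual price is at most \<open>x\<close>.\<close>

definition price_cdf :: "real \<Rightarrow> real \<Rightarrow> real \<Rightarrow> real" where
  "price_cdf c x s = \<phi> (policy s) *
     (c / \<phi> mu0 + (LBINT w:{mu0..policy s}. max (F x - F w) 0 / (\<phi> w)\<^sup>2))"

lemma excess_integrable: "b \<in> price_range \<Longrightarrow> set_integrable lborel {mu0..b} (\<lambda>w. max (F x - F w) 0 / (\<phi> w)\<^sup>2)"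
  by (rule weight_integrable[where B=1]) (auto simp: max_def cdf_nonneg algebra_simps intro: order_trans[OF cdf_bounded_prob] )

lemma price_cdf_0: "price_cdf c x 0 = c"
proof -
  have "(LBINT w:{mu0..mu0}. max (F x - F w) 0 / (\<phi> w)\<^sup>2) = 0"
    by (rule LBINT_point)
  then show ?thesis using phi_pos_range[OF mu0_in_range] by (simp add: price_cdf_def policy_0)
qed

lemma price_cdf_nonneg: "0 \<le> c \<Longrightarrow> 0 \<le> price_cdf c x s"
  unfolding price_cdf_def set_lebesgue_integral_def
  by (intro mult_nonneg_nonneg add_nonneg_nonneg Bochner_Integration.integral_nonneg divide_nonneg_nonneg phi_nonneg) auto

lemma price_cdf_continuous: "continuous_on UNIV (price_cdf c x)"
proof (rule continuous_at_imp_continuous_on, rule ballI)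
  fix s :: real
  let ?J = "\<lambda>z. LBINT w:{mu0..z}. max (F x - F w) 0 / (\<phi> w)\<^sup>2"
  have pc: "continuous_on A policy" for A
    by (rule continuous_at_imp_continuous_on) (simp add: policy_isCont)
  have "continuous_on {mu0..policy (s+1)} ?J"
    by (intro continuous_on_LBINT excess_integrable policy_in_range)
  then have "continuous_on {..s+1} (\<lambda>s. ?J (policy s))"
    by (rule continuous_on_compose2[OF _ pc]) (auto simp: policy_ge policy_mono)
  then have "isCont (\<lambda>s. ?J (policy s)) s"
    by (rule continuous_on_interior) auto
  moreover have "isCont (\<lambda>s. \<phi> (policy s)) s"
    by (rule isCont_o2[OF policy_isCont phi_isCont])
  ultimately show "isCont (price_cdf c x) s"
    unfolding price_cdf_def[abs_def] using phi_pos_range[OF mu0_in_range]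
    by (intro continuous_intros) auto
qed

lemma price_cdf_measurable [measurable]: "price_cdf c x \<in> borel_measurable borel"
  by (rule borel_measurable_continuous_onI[OF price_cdf_continuous])

text \<open>The product rule: differentiating the factor \<open>\<phi> (\<mu> s)\<close> reproduces \<open>price_cdf\<close> with the factor \<open>\<lambda> (F (\<mu> s) - 1)\<close>,
and differentiating the integral gives the other term, all powers of \<open>\<phi>\<close> cancelling.\<close>

lemma price_cdf_has_derivative:
  assumes s: "0 < s" and F: "isCont F (policy s)"
  shows "(price_cdf c x has_real_derivative
    lam * (max (F x - F (policy s)) 0 + (F (policy s) - 1) * price_cdf c x s)) (at s)"
proof -
  let ?J = "\<lambda>z. LBINT w:{mu0..z}. max (F x - F w) 0 / (\<phi> w)\<^sup>2"
  let ?m = "policy s"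
  have p: "0 < \<phi> ?m" by (rule phi_policy_pos)
  have "(?J has_real_derivative max (F x - F ?m) 0 / (\<phi> ?m)\<^sup>2) (at ?m)"
    using policy_strict_mono[of 0 s] policy_strict_mono[of s "s+1"] s
    by (intro has_real_derivative_LBINT[where b="policy (s+1)"] excess_integrable isCont_weight policy_in_range)
       (auto simp: policy_0 intro!: continuous_intros F)
  from DERIV_chain2[OF this policy_has_derivative[OF s]]
  have J: "((\<lambda>s. ?J (policy s)) has_real_derivative max (F x - F ?m) 0 / (\<phi> ?m)\<^sup>2 * (lam * \<phi> ?m)) (at s)" .
  have P: "((\<lambda>s. \<phi> (policy s)) has_real_derivative (F ?m - 1) * (lam * \<phi> ?m)) (at s)"
    by (rule DERIV_chain2[OF phi_has_derivative[OF F] policy_has_derivative[OF s]])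
  have "(price_cdf c x has_real_derivative
      (F ?m - 1) * (lam * \<phi> ?m) * (c / \<phi> mu0 + ?J ?m) +
      (0 + max (F x - F ?m) 0 / (\<phi> ?m)\<^sup>2 * (lam * \<phi> ?m)) * \<phi> ?m) (at s)"
    unfolding price_cdf_def[abs_def] by (intro DERIV_mult DERIV_add P J DERIV_const)
  then show ?thesis
    by (rule DERIV_cong) (use p in \<open>simp add: price_cdf_def power2_eq_square field_simps\<close>)
qed

text \<open>The probability of a final price at most \<open>x\<close>, seen from an offer arriving with remaining time \<open>s\<close>: the offer lies
between \<open>\<mu> s\<close> and \<open>x\<close>, or it is rejected and the process goes on.  It is written in terms of \<open>F\<close>, which is
correct when \<open>\<mu> s\<close> is not an atom of the offer distribution.\<close>

definition offer_value :: "real \<Rightarrow> real \<Rightarrow> real \<Rightarrow> real" where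
  "offer_value c x s = max (F x - F (policy s)) 0 + F (policy s) * price_cdf c x s"

lemma offer_value_measurable [measurable]: "offer_value c x \<in> borel_measurable borel"
  unfolding offer_value_def[abs_def] by measurable

lemma offer_value_nonneg: "0 \<le> c \<Longrightarrow> 0 \<le> offer_value c x s"
  unfolding offer_value_def by (simp add: price_cdf_nonneg cdf_nonneg)

lemma renewal_integrable:
  "set_integrable lborel {0..r} (\<lambda>d. lam * exp (- lam * d) * offer_value c x (r - d))"
proof -
  have "continuous_on {0..r} (\<lambda>d. price_cdf c x (r - d))"
    by (rule continuous_on_compose2[OF price_cdf_continuous]) (auto intro!: continuous_intros)
  then have "compact ((\<lambda>d. price_cdf c x (r - d)) ` {0..r})"
    by (rule compact_continuous_image) simp
  then obtain B where B: "\<And>d. 0 \<le> d \<Longrightarrow> d \<le> r \<Longrightarrow> \<bar>price_cdf c x (r - d)\<bar> \<le> B"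
    using compact_imp_bounded by (force simp: bounded_real)
  show ?thesis
  proof (rule set_integrable_bounded_Icc[where B="lam * 1 * (1 + 1 * B)"])
    fix d assume d: "0 \<le> d" "d \<le> r"
    have "\<bar>offer_value c x (r - d)\<bar> \<le> \<bar>max (F x - F (policy (r - d))) 0\<bar> + \<bar>F (policy (r - d)) * price_cdf c x (r - d)\<bar>"
      unfolding offer_value_def by (rule abs_triangle_ineq)
    also have "\<dots> \<le> 1 + 1 * B"
      unfolding abs_mult
      by (intro add_mono mult_mono B d)
         (auto simp: cdf_bounded_prob cdf_nonneg max_def algebra_simps intro: order_trans[OF cdf_bounded_prob])
    finally have "\<bar>offer_value c x (r - d)\<bar> \<le> 1 + 1 * B" .
    then show "\<bar>lam * exp (- lam * d) * offer_value c x (r - d)\<bar> \<le> lam * 1 * (1 + 1 * B)"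
      unfolding abs_mult using d lam_pos by (intro mult_mono) auto
  qed measurable
qed

text \<open>By \<open>price_cdf_has_derivative\<close>, the function \<open>- exp (- \<lambda> d) * price_cdf c x (r - d)\<close> is an antiderivative of the
integrand, except where \<open>F\<close> jumps at \<open>\<mu> (r - d)\<close>.  It runs from \<open>- price_cdf c x r\<close> to
\<open>- exp (- \<lambda> r) * c\<close>.\<close>

lemma renewal_integral:
  assumes r: "0 \<le> r"
  shows "(LBINT d:{0..r}. lam * exp (- lam * d) * offer_value c x (r - d))
    = price_cdf c x r - exp (- lam * r) * c"
proof -
  let ?V = "price_cdf c x"
  \<comment> \<open>the arrival times at which the policy meets an atom of the offer distribution\<close>
  let ?S = "(\<lambda>s. r - s) ` {s. 0 \<le> s \<and> \<not> isCont F (policy s)}"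
  have "(LBINT d:{0..r}. lam * exp (- lam * d) * offer_value c x (r - d))
     = - (exp (- lam * r) * ?V (r - r)) - - (exp (- lam * 0) * ?V (r - 0))"
  proof (rule LBINT_FTC_off_countable[OF r, where S="?S"])
    show "continuous_on {0..r} (\<lambda>d. - (exp (- lam * d) * ?V (r - d)))"
      by (intro continuous_intros continuous_on_compose2[OF price_cdf_continuous]) auto
    show "countable ?S" using countable_policy_discontinuities by (rule countable_image)
    show "set_integrable lborel {0..r} (\<lambda>d. lam * exp (- lam * d) * offer_value c x (r - d))"
      by (rule renewal_integrable)
    fix d assume d: "0 < d" "d < r" "d \<notin> ?S"
    have F: "isCont F (policy (r - d))"
    proof (rule ccontr)
      assume "\<not> ?thesis"
      then have "d \<in> ?S" using d by (intro image_eqI[of _ _ "r - d"]) auto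
      then show False using d by simp
    qed
    have minus: "((\<lambda>d. r - d) has_real_derivative - 1) (at d)"
      by (auto intro!: derivative_eq_intros)
    have V: "((\<lambda>d. ?V (r - d)) has_real_derivative
       lam * (max (F x - F (policy (r - d))) 0 + (F (policy (r - d)) - 1) * ?V (r - d)) * - 1) (at d)"
      by (rule DERIV_chain2[where f="?V", OF price_cdf_has_derivative[OF _ F] minus]) (use d in simp)
    have E: "((\<lambda>d. exp (- lam * d)) has_real_derivative exp (- lam * d) * - lam) (at d)"
      by (auto intro!: derivative_eq_intros)
    show "((\<lambda>d. - (exp (- lam * d) * ?V (r - d))) has_real_derivative
        lam * exp (- lam * d) * offer_value c x (r - d)) (at d)"
      by (rule DERIV_cong[OF DERIV_minus[OF DERIV_mult[OF E V]]])
         (simp add: offer_value_def algebra_simps)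
    have m: "isCont (\<lambda>d. r - d) d" by (intro continuous_intros)
    have "isCont (\<lambda>d. F (policy (r - d))) d"
      by (rule isCont_o2[OF isCont_o2[OF m policy_isCont] F])
    moreover have "isCont ?V (r - d)"
      using price_cdf_continuous by (simp add: continuous_on_eq_continuous_at)
    then have "isCont (\<lambda>d. ?V (r - d)) d" by (rule isCont_o2[OF m])
    ultimately show "isCont (\<lambda>d. lam * exp (- lam * d) * offer_value c x (r - d)) d"
      unfolding offer_value_def by (intro continuous_intros)
  qed
  then show ?thesis by (simp add: price_cdf_0)
qed

text \<open>The part \<open>d \<ge> r\<close>, where no offer arrives in time, contributes the term \<open>exp (- \<lambda> r) * c\<close> that \<open>renewal_integral\<close>
leaves over.\<close>

lemma renewal_equation:
  assumes r: "0 \<le> r" and c: "0 \<le> c"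
  shows "(\<integral>\<^sup>+d. ennreal (exponential_density lam d) *
     ennreal (if d < r then offer_value c x (r - d) else c) \<partial>lborel) = ennreal (price_cdf c x r)"
proof -
  let ?h = "\<lambda>d. lam * exp (- lam * d) * offer_value c x (r - d)"
  have "(\<integral>\<^sup>+d. ennreal (exponential_density lam d) * ennreal (if d < r then offer_value c x (r - d) else c) \<partial>lborel)
    = (\<integral>\<^sup>+d. ennreal (indicator {0..r} d * ?h d) + ennreal (lam * exp (- lam * d) * c) * indicator {r..} d \<partial>lborel)"
    by (rule nn_integral_cong_AE, rule AE_I'[where N="{r}"])
       (use r c lam_pos in \<open>auto simp: exponential_density_def indicator_def ennreal_mult''[symmetric] mult_ac split: if_splits\<close>)
  also have "\<dots> = (\<integral>\<^sup>+d. ennreal (indicator {0..r} d * ?h d) \<partial>lborel)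
      + (\<integral>\<^sup>+d. ennreal (lam * exp (- lam * d) * c) * indicator {r..} d \<partial>lborel)"
    by (rule nn_integral_add) auto
  also have "(\<integral>\<^sup>+d. ennreal (lam * exp (- lam * d) * c) * indicator {r..} d \<partial>lborel)
      = ennreal (0 - (- exp (- lam * r) * c))"
  proof (rule nn_integral_FTC_atLeast)
    show "((\<lambda>d. - exp (- lam * d) * c) has_real_derivative lam * exp (- lam * d) * c) (at d)" for d
      by (auto intro!: derivative_eq_intros)
    have "((\<lambda>d. exp (- lam * d)) \<longlongrightarrow> 0) at_top"
      using lam_pos
      by (auto intro!: exp_at_bot[THEN filterlim_compose] filterlim_tendsto_pos_mult_at_top[OF tendsto_const] filterlim_ident
          simp: filterlim_uminus_at_bot)
    from tendsto_mult[OF tendsto_minus[OF this] tendsto_const[of c]]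
    show "((\<lambda>d. - exp (- lam * d) * c) \<longlongrightarrow> 0) at_top" by simp
  qed (use lam_pos c in auto)
  also have "(\<integral>\<^sup>+d. ennreal (indicator {0..r} d * ?h d) \<partial>lborel) = ennreal (price_cdf c x r - exp (- lam * r) * c)"
    unfolding renewal_integral[OF r, symmetric] set_lebesgue_integral_def
    by (subst nn_integral_eq_integral[symmetric])
       (use renewal_integrable[of r c x] lam_pos c in \<open>auto simp: set_integrable_def offer_value_nonneg\<close>)
  also have "\<dots> + ennreal (0 - (- exp (- lam * r) * c)) = ennreal (price_cdf c x r)"
  proof -
    have "0 \<le> (LBINT d:{0..r}. ?h d)" unfolding set_lebesgue_integral_def
      by (rule Bochner_Integration.integral_nonneg) (use lam_pos c in \<open>auto simp: offer_value_nonneg\<close>)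
    then have "0 \<le> price_cdf c x r - exp (- lam * r) * c" unfolding renewal_integral[OF r] .
    then show ?thesis using c by (subst ennreal_plus[symmetric]) auto
  qed
  finally show ?thesis .
qed

end

section \<open>Integrating independent variables one at a time\<close>

lemma (in prob_space) indep_var_nn_integral:
  assumes ind: "indep_var S Y T Z" and g: "g \<in> borel_measurable (S \<Otimes>\<^sub>M T)"
  shows "(\<integral>\<^sup>+\<omega>. g (Y \<omega>, Z \<omega>) \<partial>M) = (\<integral>\<^sup>+\<omega>. (\<integral>\<^sup>+\<omega>'. g (Y \<omega>, Z \<omega>') \<partial>M) \<partial>M)"
proof -
  have Y: "Y \<in> measurable M S" and Z: "Z \<in> measurable M T"
    and eq: "distr M S Y \<Otimes>\<^sub>M distr M T Z = distr M (S \<Otimes>\<^sub>M T) (\<lambda>x. (Y x, Z x))"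
    using ind by (auto simp: indep_var_distribution_eq)
  interpret Z: prob_space "distr M T Z" by (rule prob_space_distr[OF Z])
  have g': "g \<in> borel_measurable (distr M S Y \<Otimes>\<^sub>M distr M T Z)"
    using g by (simp add: eq)
  have g'': "g \<in> borel_measurable (S \<Otimes>\<^sub>M distr M T Z)"
    using g by (simp cong: measurable_cong_sets sets_pair_measure_cong)
  have m: "(\<lambda>y. \<integral>\<^sup>+z. g (y, z) \<partial>distr M T Z) \<in> borel_measurable S"
    by (rule Z.borel_measurable_nn_integral_fst[OF g''])
  have "(\<integral>\<^sup>+\<omega>. g (Y \<omega>, Z \<omega>) \<partial>M) = (\<integral>\<^sup>+p. g p \<partial>distr M (S \<Otimes>\<^sub>M T) (\<lambda>x. (Y x, Z x)))"
    using Y Z g by (subst nn_integral_distr) auto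
  also have "\<dots> = (\<integral>\<^sup>+y. \<integral>\<^sup>+z. g (y, z) \<partial>distr M T Z \<partial>distr M S Y)"
    unfolding eq[symmetric] by (rule Z.nn_integral_fst[OF g', symmetric])
  also have "\<dots> = (\<integral>\<^sup>+\<omega>. \<integral>\<^sup>+z. g (Y \<omega>, z) \<partial>distr M T Z \<partial>M)"
    using Y m by (subst nn_integral_distr) auto
  also have "\<dots> = (\<integral>\<^sup>+\<omega>. (\<integral>\<^sup>+\<omega>'. g (Y \<omega>, Z \<omega>') \<partial>M) \<partial>M)"
  proof (rule nn_integral_cong)
    fix \<omega> assume "\<omega> \<in> space M"
    then have "Y \<omega> \<in> space S" using Y by (auto simp: measurable_def)
    then have "(\<lambda>z. g (Y \<omega>, z)) \<in> borel_measurable T"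
      using g by (rule measurable_Pair1'[THEN measurable_compose])
    then show "(\<integral>\<^sup>+z. g (Y \<omega>, z) \<partial>distr M T Z) = (\<integral>\<^sup>+\<omega>'. g (Y \<omega>, Z \<omega>') \<partial>M)"
      using Z by (subst nn_integral_distr) auto
  qed
  finally show ?thesis .
qed

text \<open>The form of independence used below: \<open>S\<close> and \<open>T\<close> may have different types, so that the state can be real-valued
and the next arrival time and offer a pair.\<close>

lemma (in prob_space) disjoint_coordinates_nn_integral:
  assumes ind: "indep_vars M' Z I" "A \<inter> B = {}" "A \<subseteq> I" "B \<subseteq> I"
    and f [measurable]: "f \<in> measurable (PiM A M') S" and g [measurable]: "g \<in> measurable (PiM B M') T"
    and h [measurable]: "h \<in> borel_measurable (S \<Otimes>\<^sub>M T)"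
  shows "(\<integral>\<^sup>+\<omega>. h (f (\<lambda>i\<in>A. Z i \<omega>), g (\<lambda>i\<in>B. Z i \<omega>)) \<partial>M)
    = (\<integral>\<^sup>+\<omega>. (\<integral>\<^sup>+\<omega>'. h (f (\<lambda>i\<in>A. Z i \<omega>), g (\<lambda>i\<in>B. Z i \<omega>')) \<partial>M) \<partial>M)"
  using indep_var_nn_integral[OF indep_var_restrict[OF ind], of "\<lambda>(u, v). h (f u, g v)"] by simp

section \<open>The bidding process as a Markov chain\<close>

lemma remaining_nonneg: "0 \<le> t \<Longrightarrow> 0 \<le> remaining t d n"
  by (cases n) auto

lemma remaining_le:
  assumes "0 \<le> t" "\<And>i. 1 \<le> i \<Longrightarrow> 0 \<le> d i" shows "remaining t d n \<le> t"
proof (induction n)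
  case (Suc n) then show ?case using assms(1) assms(2)[of "Suc n"] by simp
qed simp

lemma remaining_pos_imp_arrival_less:
  assumes "0 \<le> t" "\<And>i. 1 \<le> i \<Longrightarrow> 0 \<le> d i"
  shows "0 < remaining t d n \<Longrightarrow> i \<in> {1..n} \<Longrightarrow> d i < t"
proof (induction n)
  case (Suc n)
  have "d (Suc n) < remaining t d n" "remaining t d n \<le> t"
    using Suc.prems remaining_le[of t d n] assms by auto
  moreover have "0 < remaining t d n" using calculation assms(2)[of "Suc n"] by simp
  ultimately show ?case using Suc by (cases "i = Suc n") auto
qed simp

context optimal_pricing begin

text \<open>One offer, arriving after the time \<open>d\<close> and worth \<open>z\<close>, in the state \<open>r\<close>.  The state is the remaining time, or \<open>-1\<close>
once the object is sold; a real number thus records everything about the past that matters for the future.\<close>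

definition step :: "real \<Rightarrow> real \<Rightarrow> real \<Rightarrow> real" where
  "step r d z = (if r < 0 then - 1 else if 0 < r - d \<and> policy (r - d) \<le> z then - 1 else max (r - d) 0)"

text \<open>The indicator of a sale in this step at a price at most \<open>x\<close>.\<close>

definition sold_below :: "real \<Rightarrow> real \<Rightarrow> real \<Rightarrow> real \<Rightarrow> ennreal" where
  "sold_below x r d z = of_bool (0 \<le> r \<and> 0 < r - d \<and> policy (r - d) \<le> z \<and> z \<le> x)"

text \<open>The conditional probability of a future sale at a price at most \<open>x\<close>; it is \<open>0\<close> in the sold state, whose
contribution was already counted by \<open>sold_below\<close>.\<close>

definition state_value :: "real \<Rightarrow> real \<Rightarrow> real \<Rightarrow> ennreal" where
  "state_value c x r = (if r < 0 then 0 else ennreal (price_cdf c x r))"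

lemma step_measurable [measurable (raw)]:
  assumes [measurable]: "f \<in> borel_measurable M" "g \<in> borel_measurable M" "h \<in> borel_measurable M"
  shows "(\<lambda>\<omega>. step (f \<omega>) (g \<omega>) (h \<omega>)) \<in> borel_measurable M"
  unfolding step_def by measurable

lemma sold_below_measurable [measurable (raw)]:
  assumes [measurable]: "f \<in> borel_measurable M" "g \<in> borel_measurable M" "h \<in> borel_measurable M"
  shows "(\<lambda>\<omega>. sold_below x (f \<omega>) (g \<omega>) (h \<omega>)) \<in> borel_measurable M"
  unfolding sold_below_def by measurable

lemma state_value_measurable [measurable]: "state_value c x \<in> borel_measurable borel"
  unfolding state_value_def[abs_def] by measurable

text \<open>When \<open>\<mu> (r - d)\<close> is not an atom of the offer distribution, the acceptance rule \<open>z \<ge> \<mu> (r - d)\<close> and its strict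
version have the same probability, and both are expressed by \<open>F\<close>.\<close>

lemma offer_outcome:
  assumes r: "0 \<le> r" and c: "0 \<le> c" and d: "d < r" and F: "isCont F (policy (r - d))"
  shows "(\<integral>\<^sup>+z. sold_below x r d z + state_value c x (step r d z) \<partial>N) = ennreal (offer_value c x (r - d))"
proof -
  let ?m = "policy (r - d)" and ?V = "price_cdf c x (r - d)"
  have atom: "measure N {?m} = 0" using F by (simp add: isCont_cdf)
  have "measure N {..<?m} = measure N ({..?m} - {?m})" by (rule arg_cong[of _ _ "measure N"]) auto
  also have "\<dots> = F ?m" by (subst finite_measure_Diff) (auto simp: atom cdf_def2)
  finally have below: "measure N {..<?m} = F ?m" .
  have between: "measure N {?m..x} = max (F x - F ?m) 0"
  proof (cases "?m \<le> x")
    case True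
    have "measure N {?m..x} = measure N ({..x} - {..<?m})" by (rule arg_cong[of _ _ "measure N"]) auto
    also have "\<dots> = F x - F ?m" using True
      by (subst finite_measure_Diff) (auto simp: below cdf_def2)
    finally show ?thesis using cdf_nondecreasing[OF True] by simp
  next
    case False then show ?thesis using cdf_nondecreasing[of x ?m] by simp
  qed
  have "(\<integral>\<^sup>+z. sold_below x r d z + state_value c x (step r d z) \<partial>N)
      = (\<integral>\<^sup>+z. indicator {?m..x} z + ennreal ?V * indicator {..<?m} z \<partial>N)"
    using r d by (intro nn_integral_cong) (auto simp: sold_below_def state_value_def step_def indicator_def)
  also have "\<dots> = emeasure N {?m..x} + ennreal ?V * emeasure N {..<?m}"
    by (simp add: nn_integral_add nn_integral_cmult)
  also have "\<dots> = ennreal (offer_value c x (r - d))"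
    using price_cdf_nonneg[OF c]
    by (simp add: emeasure_eq_measure below between offer_value_def ennreal_mult cdf_nonneg mult.commute)
  finally show ?thesis .
qed

text \<open>The renewal equation in terms of the chain.  Atoms of the offer distribution at \<open>\<mu> (r - d)\<close> concern only
countably many \<open>d\<close>.\<close>

lemma expected_outcome_of_next_offer:
  assumes c: "0 \<le> c"
  shows "(\<integral>\<^sup>+d. ennreal (exponential_density lam d) *
     (\<integral>\<^sup>+z. sold_below x r d z + state_value c x (step r d z) \<partial>N) \<partial>lborel) = state_value c x r"
proof (cases "r < 0")
  case True then show ?thesis by (simp add: sold_below_def state_value_def step_def)
next
  case False
  then have r: "0 \<le> r" by simp
  let ?S = "(\<lambda>s. r - s) ` {s. 0 \<le> s \<and> \<not> isCont F (policy s)}"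
  have "AE d in lborel. d \<notin> ?S"
    by (intro AE_not_in countable_imp_null_set_lborel countable_image countable_policy_discontinuities)
  then have "(\<integral>\<^sup>+d. ennreal (exponential_density lam d) *
     (\<integral>\<^sup>+z. sold_below x r d z + state_value c x (step r d z) \<partial>N) \<partial>lborel)
    = (\<integral>\<^sup>+d. ennreal (exponential_density lam d) * ennreal (if d < r then offer_value c x (r - d) else c) \<partial>lborel)"
  proof (intro nn_integral_cong_AE, eventually_elim)
    fix d assume d: "d \<notin> ?S"
    show "ennreal (exponential_density lam d) * (\<integral>\<^sup>+z. sold_below x r d z + state_value c x (step r d z) \<partial>N)
      = ennreal (exponential_density lam d) * ennreal (if d < r then offer_value c x (r - d) else c)"
    proof (cases "d < r")
      case True
      have "isCont F (policy (r - d))"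
      proof (rule ccontr)
        assume "\<not> ?thesis"
        then have "d \<in> ?S" using True by (intro image_eqI[of _ _ "r - d"]) auto
        then show False using d by simp
      qed
      then show ?thesis using offer_outcome[OF r c True] True by simp
    next
      case False
      then have "sold_below x r d z + state_value c x (step r d z) = ennreal c" for z
        using r by (simp add: sold_below_def state_value_def step_def price_cdf_0)
      then show ?thesis using False emeasure_space_1 by simp
    qed
  qed
  then show ?thesis using renewal_equation[OF r c] False by (simp add: state_value_def)
qed

text \<open>A bound uniform in the remaining time, which the limit in \<open>sale_cdf\<close> needs.  It follows from \<open>F x \<le> 1\<close> and \<open>reciprocal_phi_integral\<close>.\<close>

lemma price_cdf_le: assumes c: "0 \<le> c" shows "price_cdf c x s \<le> c + 1"
proof -
  let ?p = "\<phi> (policy s)"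
  have p: "0 < ?p" "0 < \<phi> mu0" "?p \<le> \<phi> mu0"
    by (auto intro: phi_policy_pos phi_pos_range mu0_in_range phi_antimono policy_ge mu0_less_upper_end phi_pos)
  have "(LBINT w:{mu0..policy s}. max (F x - F w) 0 / (\<phi> w)\<^sup>2)
     \<le> (LBINT w:{mu0..policy s}. (1 - F w) / (\<phi> w)\<^sup>2)"
    by (rule set_integral_mono[OF excess_integrable[OF policy_in_range] weight_integrable[where B=1, OF _ _ policy_in_range]])
       (auto intro!: divide_right_mono simp: cdf_bounded_prob cdf_nonneg)
  also have "\<dots> \<le> 1 / ?p" using p by (simp add: reciprocal_phi_integral[OF policy_in_range])
  finally have "?p * (LBINT w:{mu0..policy s}. max (F x - F w) 0 / (\<phi> w)\<^sup>2) \<le> ?p * (1 / ?p)"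
    using p by (intro mult_left_mono) auto
  moreover have "?p * (c / \<phi> mu0) \<le> c"
    using p c mult_left_mono[of ?p "\<phi> mu0" c] by (simp add: field_simps)
  ultimately show ?thesis using p by (simp add: price_cdf_def distrib_left)
qed

primrec path_state :: "real \<Rightarrow> (nat \<Rightarrow> real) \<Rightarrow> (nat \<Rightarrow> real) \<Rightarrow> nat \<Rightarrow> real" where
  "path_state t d z 0 = t"
| "path_state t d z (Suc n) = step (path_state t d z n) (d (Suc n)) (z (Suc n))"

lemma path_state_cong:
  "(\<And>i. i \<in> {1..n} \<Longrightarrow> d i = d' i) \<Longrightarrow> (\<And>i. i \<in> {1..n} \<Longrightarrow> z i = z' i) \<Longrightarrow> path_state t d z n = path_state t d' z' n"
  by (induction n) auto

lemma path_state_measurable: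
  assumes "\<And>i. i \<in> {1..n} \<Longrightarrow> (\<lambda>\<omega>. d \<omega> i) \<in> borel_measurable M"
    and "\<And>i. i \<in> {1..n} \<Longrightarrow> (\<lambda>\<omega>. z \<omega> i) \<in> borel_measurable M"
  shows "(\<lambda>\<omega>. path_state t (d \<omega>) (z \<omega>) n) \<in> borel_measurable M"
  using assms by (induction n) (auto intro!: step_measurable)

text \<open>Both recursions test the offer against the same remaining time, since the maximum with \<open>0\<close> does not change a
positive number.\<close>

lemma path_state_eq:
  assumes t: "0 \<le> t"
  shows "path_state t d z n = (if \<exists>i\<le>n. accepted policy t d z i then - 1 else remaining t d n)"
proof (induction n)
  case 0 then show ?case by (simp add: accepted_def)
next
  case (Suc n)
  have "accepted policy t d z (Suc n) \<longleftrightarrow>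
      0 < remaining t d n - d (Suc n) \<and> policy (remaining t d n - d (Suc n)) \<le> z (Suc n)"
    by (auto simp: accepted_def max_def)
  then show ?case using Suc remaining_nonneg[OF t, of d n] by (auto simp: step_def le_Suc_eq)
qed

text \<open>At most one step sells, and that step determines the sale price.\<close>

lemma sum_sold_below:
  assumes t: "0 \<le> t"
  shows "(\<Sum>k<n. sold_below x (path_state t d z k) (d (Suc k)) (z (Suc k)))
    = of_bool ((\<exists>i\<le>n. accepted policy t d z i) \<and> sale_price policy t d z \<le> x)"
proof (induction n)
  case 0 then show ?case by (simp add: accepted_def)
next
  case (Suc n)
  let ?A = "accepted policy t d z"
  show ?case
  proof (cases "\<exists>i\<le>n. ?A i")
    case True
    then have "sold_below x (path_state t d z n) (d (Suc n)) (z (Suc n)) = 0"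
      by (simp add: path_state_eq[OF t] sold_below_def)
    moreover have "\<exists>i\<le>Suc n. ?A i" using True le_Suc_eq by blast
    ultimately show ?thesis using True Suc by simp
  next
    case False
    then have p: "path_state t d z n = remaining t d n" by (simp only: path_state_eq[OF t] if_False)
    have acc: "?A (Suc n) \<longleftrightarrow>
        0 < remaining t d n - d (Suc n) \<and> policy (remaining t d n - d (Suc n)) \<le> z (Suc n)"
      by (auto simp: accepted_def max_def)
    have ex: "(\<exists>i\<le>Suc n. ?A i) \<longleftrightarrow> ?A (Suc n)" using False by (auto simp: le_Suc_eq)
    have "sale_price policy t d z = z (Suc n)" if "?A (Suc n)"
    proof -
      have "(LEAST i. ?A i) = Suc n"
        by (rule Least_equality) (use that False not_less_eq_eq in blast)+
      then show ?thesis using that by (auto simp: sale_price_def)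
    qed
    then have "sold_below x (path_state t d z n) (d (Suc n)) (z (Suc n))
        = of_bool (?A (Suc n) \<and> sale_price policy t d z \<le> x)"
      unfolding p using remaining_nonneg[OF t, of d n] by (auto simp: sold_below_def acc)
    then show ?thesis using False Suc by (simp add: ex)
  qed
qed

text \<open>With non-negative inter-arrival times, the remaining time stays \<open>0\<close> and excludes later acceptances.\<close>

lemma path_state_0_imp_residual:
  assumes t: "0 \<le> t" and d: "\<And>i. 1 \<le> i \<Longrightarrow> 0 \<le> d i" and p: "path_state t d z n = 0"
  shows "sale_price policy t d z = z 0"
proof -
  have no: "\<not> accepted policy t d z i" if "i \<le> n" for i
    using p that by (auto simp: path_state_eq[OF t] split: if_splits)
  then have r: "remaining t d n = 0" using p by (auto simp: path_state_eq[OF t] split: if_splits)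
  have "remaining t d (n + k) = 0" for k
    by (induction k) (use r d in auto)
  then have "remaining t d i = 0" if "n \<le> i" for i using that by (metis le_add_diff_inverse)
  then have "\<not> accepted policy t d z i" for i
    using no by (cases "i \<le> n") (auto simp: accepted_def)
  then show ?thesis by (simp add: sale_price_def)
qed

text \<open>Acceptance is only tested at positive remaining times, where \<open>policy\<close> is the optimal policy.\<close>

lemma sale_price_policy: "sale_price (optimal_policy lam F mu0) = sale_price policy"
proof -
  have "accepted (optimal_policy lam F mu0) = accepted policy"
    by (intro ext) (auto simp: accepted_def policy_def max_def)
  then show ?thesis by (intro ext) (simp add: sale_price_def)
qed

end

section \<open>The distribution of the sale price\<close>

locale bidding_process = optimal_pricing N mu0 lam + P: prob_space P
  for N mu0 lam and P :: "'a measure" +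
  fixes D X :: "nat \<Rightarrow> 'a \<Rightarrow> real" and t :: real
  assumes independent: "P.indep_vars (\<lambda>_. borel) (case_sum D X) ({1..} <+> UNIV)"
    and D_exponential: "\<And>i. 1 \<le> i \<Longrightarrow> distributed P lborel (D i) (exponential_density lam)"
    and X_distr: "\<And>i. 1 \<le> i \<Longrightarrow> distr P borel (X i) = N"
    and t_nonneg: "0 \<le> t"
begin

abbreviation state :: "nat \<Rightarrow> 'a \<Rightarrow> real" where
  "state n \<omega> \<equiv> path_state t (\<lambda>i. D i \<omega>) (\<lambda>i. X i \<omega>) n"

definition sale :: "'a \<Rightarrow> real" where
  "sale \<omega> = sale_price policy t (\<lambda>i. D i \<omega>) (\<lambda>i. X i \<omega>)"

lemma D_measurable: "1 \<le> i \<Longrightarrow> D i \<in> borel_measurable P"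
  using P.indep_vars_def2[THEN iffD1, OF independent] by force

lemma X_measurable [measurable]: "X i \<in> borel_measurable P"
  using P.indep_vars_def2[THEN iffD1, OF independent] by force

lemma D_Suc_measurable [measurable]: "D (Suc i) \<in> borel_measurable P"
  by (rule D_measurable) simp

lemma state_measurable [measurable]: "state n \<in> borel_measurable P"
  by (rule path_state_measurable) (auto intro: D_measurable)

text \<open>The state after \<open>n\<close> offers is a function of the first \<open>n\<close> inter-arrival times and offers, hence independent of all
other coordinates.\<close>

lemma state_nn_integral:
  assumes B: "B \<subseteq> {1..} <+> UNIV" "(Inl ` {1..n} \<union> Inr ` {1..n}) \<inter> B = {}"
    and g: "g \<in> measurable (PiM B (\<lambda>_. borel)) T" and h: "h \<in> borel_measurable (borel \<Otimes>\<^sub>M T)"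
  shows "(\<integral>\<^sup>+\<omega>. h (state n \<omega>, g (\<lambda>i\<in>B. case_sum D X i \<omega>)) \<partial>P)
    = (\<integral>\<^sup>+\<omega>. (\<integral>\<^sup>+\<omega>'. h (state n \<omega>, g (\<lambda>i\<in>B. case_sum D X i \<omega>')) \<partial>P) \<partial>P)"
proof -
  let ?A = "Inl ` {1..n} \<union> Inr ` {1..n} :: (nat + nat) set"
  let ?f = "\<lambda>u. path_state t (\<lambda>i. u (Inl i)) (\<lambda>i. u (Inr i)) n"
  have st: "?f (\<lambda>i\<in>?A. case_sum D X i \<omega>) = state n \<omega>" for \<omega>
    by (intro path_state_cong) auto
  have f: "?f \<in> measurable (PiM ?A (\<lambda>_. borel)) borel"
    by (rule path_state_measurable) (auto intro!: measurable_component_singleton)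
  have "?A \<subseteq> {1..} <+> UNIV" by auto
  from P.disjoint_coordinates_nn_integral[OF independent B(2) this B(1) f g h]
  show ?thesis unfolding st .
qed

lemma state_offer_nn_integral:
  assumes "h \<in> borel_measurable (borel \<Otimes>\<^sub>M (borel \<Otimes>\<^sub>M borel))"
  shows "(\<integral>\<^sup>+\<omega>. h (state n \<omega>, D (Suc n) \<omega>, X (Suc n) \<omega>) \<partial>P)
    = (\<integral>\<^sup>+\<omega>. (\<integral>\<^sup>+\<omega>'. h (state n \<omega>, D (Suc n) \<omega>', X (Suc n) \<omega>') \<partial>P) \<partial>P)"
  using state_nn_integral[of "{Inl (Suc n), Inr (Suc n)}" n "\<lambda>u. (u (Inl (Suc n)), u (Inr (Suc n)))" "borel \<Otimes>\<^sub>M borel" h] assms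
  by (auto simp: Plus_def image_iff intro!: measurable_Pair measurable_component_singleton)

lemma state_residual_nn_integral:
  assumes "h \<in> borel_measurable (borel \<Otimes>\<^sub>M borel)"
  shows "(\<integral>\<^sup>+\<omega>. h (state n \<omega>, X 0 \<omega>) \<partial>P) = (\<integral>\<^sup>+\<omega>. (\<integral>\<^sup>+\<omega>'. h (state n \<omega>, X 0 \<omega>') \<partial>P) \<partial>P)"
  using state_nn_integral[of "{Inr 0}" n "\<lambda>u. u (Inr 0)" borel h] assms
  by (auto simp: Plus_def image_iff intro!: measurable_component_singleton)

lemma arrival_offer_nn_integral:
  assumes "h \<in> borel_measurable (borel \<Otimes>\<^sub>M borel)"
  shows "(\<integral>\<^sup>+\<omega>. h (D (Suc n) \<omega>, X (Suc n) \<omega>) \<partial>P)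
    = (\<integral>\<^sup>+\<omega>. (\<integral>\<^sup>+\<omega>'. h (D (Suc n) \<omega>, X (Suc n) \<omega>') \<partial>P) \<partial>P)"
  using P.disjoint_coordinates_nn_integral[OF independent, of "{Inl (Suc n)}" "{Inr (Suc n)}" "\<lambda>u. u (Inl (Suc n))" borel
     "\<lambda>u. u (Inr (Suc n))" borel h] assms
  by (auto simp: Plus_def image_iff intro!: measurable_component_singleton)

text \<open>Given the state, the next arrival time and the next offer can be integrated out separately, which leaves
\<open>expected_outcome_of_next_offer\<close>.\<close>

lemma expected_step:
  assumes c: "0 \<le> c"
  shows "(\<integral>\<^sup>+\<omega>. sold_below x (state n \<omega>) (D (Suc n) \<omega>) (X (Suc n) \<omega>) + state_value c x (state (Suc n) \<omega>) \<partial>P)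
    = (\<integral>\<^sup>+\<omega>. state_value c x (state n \<omega>) \<partial>P)"
proof -
  define h where "h r d z = sold_below x r d z + state_value c x (step r d z)" for r d z
  have h [measurable]: "(\<lambda>\<omega>. h (f \<omega>) (g \<omega>) (k \<omega>)) \<in> borel_measurable M"
    if "f \<in> borel_measurable M" "g \<in> borel_measurable M" "k \<in> borel_measurable M" for f g k and M :: "'b measure"
    using that unfolding h_def by measurable
  have inner: "(\<integral>\<^sup>+\<omega>'. h r (D (Suc n) \<omega>') (X (Suc n) \<omega>') \<partial>P) = state_value c x r" for r
  proof -
    have "(\<integral>\<^sup>+\<omega>'. h r (D (Suc n) \<omega>') (X (Suc n) \<omega>') \<partial>P)
        = (\<integral>\<^sup>+\<omega>. \<integral>\<^sup>+\<omega>'. h r (D (Suc n) \<omega>) (X (Suc n) \<omega>') \<partial>P \<partial>P)"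
      using arrival_offer_nn_integral[of "\<lambda>(d, z). h r d z" n] unfolding h_def by simp
    also have "\<dots> = (\<integral>\<^sup>+\<omega>. (\<integral>\<^sup>+z. h r (D (Suc n) \<omega>) z \<partial>N) \<partial>P)"
      unfolding h_def by (subst X_distr[of "Suc n", symmetric]) (simp_all add: nn_integral_distr)
    also have "\<dots> = (\<integral>\<^sup>+d. ennreal (exponential_density lam d) * (\<integral>\<^sup>+z. h r d z \<partial>N) \<partial>lborel)"
      unfolding h_def
      by (rule distributed_nn_integral[OF D_exponential, symmetric]) auto
    also have "\<dots> = state_value c x r" unfolding h_def by (rule expected_outcome_of_next_offer[OF c])
    finally show ?thesis .
  qed
  have "(\<integral>\<^sup>+\<omega>. h (state n \<omega>) (D (Suc n) \<omega>) (X (Suc n) \<omega>) \<partial>P)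
     = (\<integral>\<^sup>+\<omega>. \<integral>\<^sup>+\<omega>'. h (state n \<omega>) (D (Suc n) \<omega>') (X (Suc n) \<omega>') \<partial>P \<partial>P)"
    using state_offer_nn_integral[of "\<lambda>(r, d, z). h r d z" n] unfolding h_def by simp
  then show ?thesis by (simp add: inner) (simp add: h_def)
qed

text \<open>The martingale property, started from the deterministic state \<open>t\<close>.\<close>

lemma expected_total:
  assumes c: "0 \<le> c"
  shows "(\<integral>\<^sup>+\<omega>. (\<Sum>k<n. sold_below x (state k \<omega>) (D (Suc k) \<omega>) (X (Suc k) \<omega>)) + state_value c x (state n \<omega>) \<partial>P)
    = ennreal (price_cdf c x t)"
proof (induction n)
  case 0 then show ?case using t_nonneg by (simp add: state_value_def P.emeasure_space_1)
next
  case (Suc n)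
  let ?s = "\<lambda>k \<omega>. sold_below x (state k \<omega>) (D (Suc k) \<omega>) (X (Suc k) \<omega>)"
  have "(\<integral>\<^sup>+\<omega>. (\<Sum>k<Suc n. ?s k \<omega>) + state_value c x (state (Suc n) \<omega>) \<partial>P)
      = (\<integral>\<^sup>+\<omega>. (\<Sum>k<n. ?s k \<omega>) + (?s n \<omega> + state_value c x (state (Suc n) \<omega>)) \<partial>P)"
    by (simp add: add.assoc)
  also have "\<dots> = (\<integral>\<^sup>+\<omega>. (\<Sum>k<n. ?s k \<omega>) \<partial>P) + (\<integral>\<^sup>+\<omega>. state_value c x (state n \<omega>) \<partial>P)"
    by (subst nn_integral_add) (simp_all only: expected_step[OF c], measurable)
  also have "\<dots> = (\<integral>\<^sup>+\<omega>. (\<Sum>k<n. ?s k \<omega>) + state_value c x (state n \<omega>) \<partial>P)"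
    by (subst nn_integral_add) auto
  finally show ?case using Suc by simp
qed

lemma sale_measurable [measurable]: "sale \<in> borel_measurable P"
proof -
  have rem [measurable]: "(\<lambda>\<omega>. remaining t (\<lambda>i. D i \<omega>) n) \<in> borel_measurable P" for n
    by (induction n) auto
  have acc [measurable]: "Measurable.pred P (\<lambda>\<omega>. accepted policy t (\<lambda>i. D i \<omega>) (\<lambda>i. X i \<omega>) i)" for i
    unfolding accepted_def by measurable
  have [measurable]: "(\<lambda>\<omega>. X (LEAST i. accepted policy t (\<lambda>i. D i \<omega>) (\<lambda>i. X i \<omega>) i) \<omega>) \<in> borel_measurable P"
    by (rule measurable_compose_countable) measurable
  show ?thesis unfolding sale_def[abs_def] sale_price_def by measurable
qed

lemma D_nonneg: "AE \<omega> in P. \<forall>i\<ge>1. 0 \<le> D i \<omega>"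
proof -
  have "AE \<omega> in P. 1 \<le> i \<longrightarrow> 0 \<le> D i \<omega>" for i
  proof (cases "1 \<le> i")
    case True
    have "AE d in lborel. 0 < ennreal (exponential_density lam d) \<longrightarrow> 0 \<le> d"
      by (auto simp: exponential_density_def)
    then have "AE d in density lborel (\<lambda>d. ennreal (exponential_density lam d)). 0 \<le> d"
      by (subst AE_density) auto
    then have "AE d in distr P lborel (D i). 0 \<le> d"
      by (subst distributed_distr_eq_density[OF D_exponential[OF True]])
    then have "AE \<omega> in P. 0 \<le> D i \<omega>"
      using D_measurable[OF True] by (subst (asm) AE_distr_iff) auto
    then show ?thesis by simp
  qed simp
  then have "AE \<omega> in P. \<forall>i. 1 \<le> i \<longrightarrow> 0 \<le> D i \<omega>" by (simp add: AE_all_countable)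
  then show ?thesis by simp
qed

text \<open>Remaining time after \<open>n\<close> offers forces each of the first \<open>n\<close> inter-arrival times below \<open>t\<close>, which has probability
at most \<open>(1 - exp (- \<lambda> t))\<^sup>n\<close>.\<close>

lemma undecided_tendsto_0: "(\<lambda>n. P.prob {\<omega>\<in>space P. 0 < state n \<omega>}) \<longlonglongrightarrow> 0"
proof -
  define q where "q = 1 - exp (- t * lam)"
  have q: "0 \<le> q" "q < 1" using t_nonneg lam_pos by (auto simp: q_def)
  have bound: "P.prob {\<omega>\<in>space P. 0 < state n \<omega>} \<le> q ^ n" if "0 < n" for n
  proof -
    let ?B = "\<Inter>i\<in>Inl ` {1..n}. case_sum D X i -` {..t} \<inter> space P"
    have "?B = space P \<inter> (\<Inter>i\<in>{1..n}. D i -` {..t})" using that by auto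
    have ev: "?B \<in> sets P"
      using that by (intro sets.finite_INT) (auto intro!: measurable_sets[OF D_measurable])
    have "P.prob {\<omega>\<in>space P. 0 < state n \<omega>} \<le> P.prob ?B"
    proof (rule P.finite_measure_mono_AE[OF _ ev])
      show "AE \<omega> in P. \<omega> \<in> {\<omega>\<in>space P. 0 < state n \<omega>} \<longrightarrow> \<omega> \<in> ?B"
        using D_nonneg
      proof eventually_elim
        fix \<omega> assume d: "\<forall>i\<ge>1. 0 \<le> D i \<omega>"
        show "\<omega> \<in> {\<omega>\<in>space P. 0 < state n \<omega>} \<longrightarrow> \<omega> \<in> ?B"
        proof
          assume w: "\<omega> \<in> {\<omega>\<in>space P. 0 < state n \<omega>}"
          then have "0 < remaining t (\<lambda>i. D i \<omega>) n"
            by (auto simp: path_state_eq[OF t_nonneg] split: if_splits)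
          then have "D i \<omega> < t" if "i \<in> {1..n}" for i
            using remaining_pos_imp_arrival_less[OF t_nonneg, of "\<lambda>i. D i \<omega>"] d that by blast
          then show "\<omega> \<in> ?B" using w by (auto intro: less_imp_le)
        qed
      qed
    qed
    also have "P.prob ?B = (\<Prod>i\<in>Inl ` {1..n}. P.prob (case_sum D X i -` {..t} \<inter> space P))"
      by (rule P.indep_varsD[OF independent]) (use that in auto)
    also have "\<dots> = (\<Prod>i\<in>{1..n}. P.prob (D i -` {..t} \<inter> space P))"
      by (subst prod.reindex) auto
    also have "\<dots> = (\<Prod>i\<in>{1..n}. q)"
    proof (rule prod.cong[OF refl])
      fix i assume "i \<in> {1..n}"
      then have "P.prob {\<omega>\<in>space P. D i \<omega> \<le> t} = q"
        using P.exponential_distributedD_le[OF D_exponential t_nonneg lam_pos] by (simp add: q_def)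
      moreover have "D i -` {..t} \<inter> space P = {\<omega>\<in>space P. D i \<omega> \<le> t}" by auto
      ultimately show "P.prob (D i -` {..t} \<inter> space P) = q" by simp
    qed
    also have "\<dots> = q ^ n" by simp
    finally show ?thesis .
  qed
  show ?thesis
  proof (rule Lim_null_comparison)
    show "\<forall>\<^sub>F n in sequentially. norm (P.prob {\<omega>\<in>space P. 0 < state n \<omega>}) \<le> q ^ n"
      using eventually_gt_at_top[of 0] by eventually_elim (use bound in auto)
    show "(\<lambda>n. q ^ n) \<longlonglongrightarrow> 0" by (rule LIMSEQ_realpow_zero[OF q])
  qed
qed

text \<open>Both sides split, for every \<open>n\<close>, into the same part \<open>A n\<close> coming from states that are sold or have no time left, and
a part on the event that the state is still positive, which is at most \<open>c + 1\<close> times the probability of that event.\<close>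

lemma sale_cdf:
  shows "P.prob {\<omega>\<in>space P. sale \<omega> \<le> x} = price_cdf (P.prob {\<omega>\<in>space P. X 0 \<omega> \<le> x}) x t"
proof -
  define c where "c = P.prob {\<omega>\<in>space P. X 0 \<omega> \<le> x}"
  have c: "0 \<le> c" by (simp add: c_def)
  let ?V = "price_cdf c x"
  let ?p = "P.prob {\<omega>\<in>space P. sale \<omega> \<le> x}"
  let ?U = "\<lambda>n. {\<omega>\<in>space P. 0 < state n \<omega>}"
  define sold where "sold n \<omega> = (\<Sum>k<n. sold_below x (state k \<omega>) (D (Suc k) \<omega>) (X (Suc k) \<omega>))" for n \<omega>
  have [measurable]: "sold n \<in> borel_measurable P" for n unfolding sold_def[abs_def] by measurable
  \<comment> \<open>the part that both probabilities have in common: sold within \<open>n\<close> offers at a price at most \<open>x\<close>, or no time left and a residual price at most \<open>x\<close>\<close>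
  define A where "A n = (\<integral>\<^sup>+\<omega>. sold n \<omega> \<partial>P) + ennreal c * emeasure P {\<omega>\<in>space P. state n \<omega> = 0}" for n
  have V: "ennreal (?V t) = A n + (\<integral>\<^sup>+\<omega>. ennreal (?V (state n \<omega>)) * indicator (?U n) \<omega> \<partial>P)" for n
  proof -
    have "ennreal (?V t) = (\<integral>\<^sup>+\<omega>. sold n \<omega> + state_value c x (state n \<omega>) \<partial>P)"
      using expected_total[OF c, of x n] by (simp add: sold_def)
    also have "\<dots> = (\<integral>\<^sup>+\<omega>. (sold n \<omega> + ennreal c * indicator {\<omega>\<in>space P. state n \<omega> = 0} \<omega>)
        + ennreal (?V (state n \<omega>)) * indicator (?U n) \<omega> \<partial>P)"
      by (intro nn_integral_cong) (auto simp: state_value_def indicator_def price_cdf_0)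
    also have "\<dots> = A n + (\<integral>\<^sup>+\<omega>. ennreal (?V (state n \<omega>)) * indicator (?U n) \<omega> \<partial>P)"
      unfolding A_def by (simp add: nn_integral_add nn_integral_cmult)
    finally show ?thesis .
  qed
  have S: "ennreal ?p = A n + emeasure P {\<omega>\<in>space P. 0 < state n \<omega> \<and> sale \<omega> \<le> x}" for n
  proof -
    have "ennreal ?p = (\<integral>\<^sup>+\<omega>. indicator {\<omega>\<in>space P. sale \<omega> \<le> x} \<omega> \<partial>P)"
      by (simp add: P.emeasure_eq_measure)
    also have "\<dots> = (\<integral>\<^sup>+\<omega>. (sold n \<omega> + indicator {\<omega>\<in>space P. state n \<omega> = 0 \<and> X 0 \<omega> \<le> x} \<omega>)
        + indicator {\<omega>\<in>space P. 0 < state n \<omega> \<and> sale \<omega> \<le> x} \<omega> \<partial>P)"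
    proof (rule nn_integral_cong_AE, use D_nonneg AE_space in eventually_elim)
      fix \<omega> assume d: "\<forall>i\<ge>1. 0 \<le> D i \<omega>" and w: "\<omega> \<in> space P"
      let ?acc = "\<exists>i\<le>n. accepted policy t (\<lambda>i. D i \<omega>) (\<lambda>i. X i \<omega>) i"
      have s: "sold n \<omega> = of_bool (?acc \<and> sale \<omega> \<le> x)"
        unfolding sold_def sale_def by (rule sum_sold_below[OF t_nonneg])
      have st: "state n \<omega> = (if ?acc then - 1 else remaining t (\<lambda>i. D i \<omega>) n)"
        by (rule path_state_eq[OF t_nonneg])
      have res: "sale \<omega> = X 0 \<omega>" if "state n \<omega> = 0"
        unfolding sale_def by (rule path_state_0_imp_residual[OF t_nonneg _ that]) (use d in auto)
      consider "?acc" "state n \<omega> = - 1" | "\<not> ?acc" "state n \<omega> = 0" | "\<not> ?acc" "0 < state n \<omega>"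
        using st remaining_nonneg[OF t_nonneg, of "\<lambda>i. D i \<omega>" n] by (cases ?acc) (auto simp: order_le_less)
      then show "indicator {\<omega>\<in>space P. sale \<omega> \<le> x} \<omega> = (sold n \<omega> + indicator {\<omega>\<in>space P. state n \<omega> = 0 \<and> X 0 \<omega> \<le> x} \<omega>)
        + (indicator {\<omega>\<in>space P. 0 < state n \<omega> \<and> sale \<omega> \<le> x} \<omega> :: ennreal)"
        using w res by cases (simp_all add: s indicator_def)
    qed
    also have "\<dots> = (\<integral>\<^sup>+\<omega>. sold n \<omega> \<partial>P) + emeasure P {\<omega>\<in>space P. state n \<omega> = 0 \<and> X 0 \<omega> \<le> x}
        + emeasure P {\<omega>\<in>space P. 0 < state n \<omega> \<and> sale \<omega> \<le> x}"
      by (simp add: nn_integral_add)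
    also have "emeasure P {\<omega>\<in>space P. state n \<omega> = 0 \<and> X 0 \<omega> \<le> x} = ennreal c * emeasure P {\<omega>\<in>space P. state n \<omega> = 0}"
    proof -
      have "emeasure P {\<omega>\<in>space P. state n \<omega> = 0 \<and> X 0 \<omega> \<le> x}
          = (\<integral>\<^sup>+\<omega>. indicator {\<omega>\<in>space P. state n \<omega> = 0 \<and> X 0 \<omega> \<le> x} \<omega> \<partial>P)"
        by (rule nn_integral_indicator[symmetric]) measurable
      also have "\<dots> = (\<integral>\<^sup>+\<omega>. indicator ({0} \<times> {..x}) (state n \<omega>, X 0 \<omega>) \<partial>P)"
        by (intro nn_integral_cong) (auto simp: indicator_def)
      also have "\<dots> = (\<integral>\<^sup>+\<omega>. (\<integral>\<^sup>+\<omega>'. indicator ({0} \<times> {..x}) (state n \<omega>, X 0 \<omega>') \<partial>P) \<partial>P)"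
        by (rule state_residual_nn_integral) measurable
      also have "\<dots> = (\<integral>\<^sup>+\<omega>. (\<integral>\<^sup>+\<omega>'. indicator {\<omega>\<in>space P. X 0 \<omega> \<le> x} \<omega>' * indicator {\<omega>\<in>space P. state n \<omega> = 0} \<omega> \<partial>P) \<partial>P)"
        by (intro nn_integral_cong) (auto simp: indicator_def)
      also have "\<dots> = ennreal c * emeasure P {\<omega>\<in>space P. state n \<omega> = 0}"
        by (simp add: nn_integral_multc nn_integral_cmult P.emeasure_eq_measure c_def)
      finally show ?thesis .
    qed
    finally show ?thesis by (simp add: A_def)
  qed
  have up: "?p \<le> ?V t + P.prob (?U n)" for n
  proof -
    have "ennreal ?p \<le> ennreal (?V t) + emeasure P (?U n)"
      unfolding S[of n] V[of n] by (intro add_mono emeasure_mono) auto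
    then show ?thesis using price_cdf_nonneg[OF c, of x t]
      by (simp add: P.emeasure_eq_measure ennreal_plus[symmetric] del: ennreal_plus)
  qed
  have low: "?V t \<le> ?p + (c + 1) * P.prob (?U n)" for n
  proof -
    have "(\<integral>\<^sup>+\<omega>. ennreal (?V (state n \<omega>)) * indicator (?U n) \<omega> \<partial>P) \<le> (\<integral>\<^sup>+\<omega>. ennreal (c + 1) * indicator (?U n) \<omega> \<partial>P)"
      by (intro nn_integral_mono mult_right_mono ennreal_leI price_cdf_le c) auto
    also have "\<dots> = ennreal ((c + 1) * P.prob (?U n))"
      using c by (simp add: nn_integral_cmult P.emeasure_eq_measure ennreal_mult)
    finally have "ennreal (?V t) \<le> ennreal ?p + ennreal ((c + 1) * P.prob (?U n))"
      unfolding V[of n] S[of n] by (intro add_mono order_refl) (auto intro: add_increasing2)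
    then show ?thesis using c by (simp add: ennreal_plus[symmetric] del: ennreal_plus)
  qed
  have "?p \<le> ?V t + 0"
    by (rule LIMSEQ_le_const[OF tendsto_add[OF tendsto_const undecided_tendsto_0]]) (use up in auto)
  moreover have "?V t \<le> ?p + (c + 1) * 0"
    by (rule LIMSEQ_le_const[OF tendsto_add[OF tendsto_const tendsto_mult[OF tendsto_const undecided_tendsto_0]]]) (use low in auto)
  ultimately show ?thesis by (simp add: c_def)
qed

text \<open>The factor of \<open>f u\<close> in the density is \<open>K u\<close>, the integral of \<open>1/\<phi>\<^sup>2\<close> over those \<open>w\<close> in \<open>[mu0, \<mu> t]\<close> with \<open>w \<le> u\<close>.  Integrating
\<open>f u * K u\<close> over \<open>u \<le> x\<close> and exchanging the integrals replaces \<open>f\<close> by its integral over \<open>[w, x]\<close>,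
which is \<open>(F x - F w)\<^sub>+\<close>.  So \<open>g\<close> has the same integrals over half-lines as the law found in \<open>sale_cdf\<close>.\<close>

lemma sale_distributed:
  fixes f f0 g :: "real \<Rightarrow> real"
  assumes f_nonneg: "\<And>x. 0 \<le> f x" and f0_nonneg: "\<And>x. 0 \<le> f0 x"
    and f: "distributed P lborel (X 1) f" and f0: "distributed P lborel (X 0) f0"
    and g: "\<And>x. x \<noteq> policy t \<Longrightarrow>
      g x = \<phi> (policy t) * (f0 x / \<phi> mu0) + \<phi> (policy t) * f x *
        (if x < mu0 then 0
         else if x < policy t then (LBINT w:{mu0..x}. 1 / (\<phi> w)\<^sup>2)
         else (LBINT w:{mu0..policy t}. 1 / (\<phi> w)\<^sup>2))"
  shows "distributed P lborel sale g"
proof -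
  let ?m = "policy t" and ?W = "\<lambda>w. indicator {mu0..policy t} w / (\<phi> w)\<^sup>2"
  have [measurable]: "f \<in> borel_measurable borel" "f0 \<in> borel_measurable borel"
    using distributed_real_measurable[OF _ f] distributed_real_measurable[OF _ f0] f_nonneg f0_nonneg by auto
  have p: "0 < \<phi> ?m" "0 < \<phi> mu0" by (auto intro: phi_policy_pos phi_pos mu0_less_upper_end)
  \<comment> \<open>a single formula for the three cases of the density, since the interval \<open>[mu0, min u (\<mu> t)]\<close> is empty for \<open>u < mu0\<close>\<close>
  define K where "K u = (\<integral>w. indicator {..u} w * ?W w \<partial>lborel)" for u
  have K_eq: "K u = (LBINT w:{mu0..min u ?m}. 1 / (\<phi> w)\<^sup>2)" for u
    unfolding K_def set_lebesgue_integral_def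
    by (intro Bochner_Integration.integral_cong) (auto simp: indicator_def)
  have K_int: "integrable lborel (\<lambda>w. indicator {..u} w * ?W w)" for u
  proof -
    have "set_integrable lborel {mu0..?m} (\<lambda>w. 1 / (\<phi> w)\<^sup>2)"
      by (rule weight_integrable[where B=1, OF _ _ policy_in_range]) auto
    then have "set_integrable lborel {mu0..min u ?m} (\<lambda>w. 1 / (\<phi> w)\<^sup>2)"
      by (rule set_integrable_subset) auto
    then show ?thesis unfolding set_integrable_def
      by (rule Bochner_Integration.integrable_cong[THEN iffD1, rotated 2]) (auto simp: indicator_def)
  qed
  have K_measurable [measurable]: "K \<in> borel_measurable borel"
  proof (intro borel_measurable_mono monoI)
    fix u v :: real assume "u \<le> v"
    then show "K u \<le> K v"
      unfolding K_def by (intro integral_mono[OF K_int K_int]) (auto simp: indicator_def)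
  qed
  have K_nn: "ennreal (K u) = (\<integral>\<^sup>+w. ennreal (?W w) * indicator {..u} w \<partial>lborel)" for u
    unfolding K_def
    by (subst nn_integral_eq_integral[OF K_int, symmetric])
       (auto intro!: nn_integral_cong simp: indicator_def)
  have K_nonneg: "0 \<le> K u" for u
    unfolding K_def by (rule Bochner_Integration.integral_nonneg) simp
  define k where "k u = \<phi> ?m * (f0 u / \<phi> mu0) + \<phi> ?m * f u * K u" for u
  have k_measurable [measurable]: "k \<in> borel_measurable borel" unfolding k_def[abs_def] by measurable
  have gk: "g u = k u" if "u \<noteq> ?m" for u
    using g[OF that] policy_ge[of t] by (auto simp: k_def K_eq min_def set_lebesgue_integral_def)
  have g_measurable [measurable]: "g \<in> borel_measurable borel"
  proof -
    have "g = (\<lambda>u. if u = ?m then g ?m else k u)" using gk by auto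
    also have "\<dots> \<in> borel_measurable borel" by measurable
    finally show ?thesis .
  qed
  have N_eq: "N = density lborel f"
    using distributed_distr_eq_density[OF f] X_distr[of 1] by (simp cong: distr_cong)
  have N_Icc: "(\<integral>\<^sup>+u. ennreal (f u) * indicator {w..x} u \<partial>lborel) = ennreal (max (F x - F w) 0)" for w x
  proof -
    have *: "(\<integral>\<^sup>+u. ennreal (f u) * indicator A u \<partial>lborel) = emeasure N A" if "A \<in> sets borel" for A
      unfolding N_eq using that by (subst emeasure_density) auto
    have "(\<integral>\<^sup>+u. ennreal (f u) * indicator {w..x} u \<partial>lborel) = (\<integral>\<^sup>+u. ennreal (f u) * indicator {w<..x} u \<partial>lborel)"
      by (rule nn_integral_cong_AE, rule AE_I'[where N="{w}"]) (auto simp: indicator_def split: if_splits)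
    also have "\<dots> = emeasure N {w<..x}" by (rule *) simp
    also have "\<dots> = ennreal (max (F x - F w) 0)"
    proof (cases "w \<le> x")
      case True
      then show ?thesis using cdf_nondecreasing[OF True] cdf_diff_eq[of w x]
        by (cases "w = x") (auto simp: emeasure_eq_measure)
    next
      case False then show ?thesis using cdf_nondecreasing[of x w] by simp
    qed
    finally show ?thesis .
  qed
  have accepted_part: "(\<integral>\<^sup>+u. ennreal (f u) * ennreal (K u) * indicator {..x} u \<partial>lborel)
     = ennreal (LBINT w:{mu0..?m}. max (F x - F w) 0 / (\<phi> w)\<^sup>2)" for x
  proof -
    have "(\<integral>\<^sup>+u. ennreal (f u) * ennreal (K u) * indicator {..x} u \<partial>lborel)
      = (\<integral>\<^sup>+u. (\<integral>\<^sup>+w. ennreal (?W w) * (ennreal (f u) * indicator {w..x} u) \<partial>lborel) \<partial>lborel)"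
    proof (rule nn_integral_cong)
      fix u
      have "ennreal (f u) * ennreal (K u) * indicator {..x} u =
          (\<integral>\<^sup>+w. (ennreal (f u) * indicator {..x} u) * (ennreal (?W w) * indicator {..u} w) \<partial>lborel)"
        by (subst nn_integral_cmult) (auto simp: K_nn mult_ac)
      also have "\<dots> = (\<integral>\<^sup>+w. ennreal (?W w) * (ennreal (f u) * indicator {w..x} u) \<partial>lborel)"
        by (rule nn_integral_cong) (auto simp: indicator_def mult.commute)
      finally show "ennreal (f u) * ennreal (K u) * indicator {..x} u
        = (\<integral>\<^sup>+w. ennreal (?W w) * (ennreal (f u) * indicator {w..x} u) \<partial>lborel)" .
    qed
    also have "\<dots> = (\<integral>\<^sup>+w. (\<integral>\<^sup>+u. ennreal (?W w) * (ennreal (f u) * indicator {w..x} u) \<partial>lborel) \<partial>lborel)"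
      by (rule lborel_pair.Fubini') (simp add: indicator_def, measurable)
    also have "\<dots> = (\<integral>\<^sup>+w. ennreal (?W w) * ennreal (max (F x - F w) 0) \<partial>lborel)"
      by (intro nn_integral_cong) (simp add: nn_integral_cmult N_Icc)
    also have "\<dots> = (\<integral>\<^sup>+w. ennreal (indicator {mu0..?m} w *\<^sub>R (max (F x - F w) 0 / (\<phi> w)\<^sup>2)) \<partial>lborel)"
      by (intro nn_integral_cong, subst ennreal_mult[symmetric]) (auto simp: indicator_def)
    also have "\<dots> = ennreal (LBINT w:{mu0..?m}. max (F x - F w) 0 / (\<phi> w)\<^sup>2)"
      unfolding set_lebesgue_integral_def
      by (rule nn_integral_eq_integral)
         (use excess_integrable[OF policy_in_range] in \<open>auto simp: set_integrable_def\<close>)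
    finally show ?thesis .
  qed
  have residual_part: "(\<integral>\<^sup>+u. ennreal (f0 u) * indicator {..x} u \<partial>lborel)
      = ennreal (P.prob {\<omega>\<in>space P. X 0 \<omega> \<le> x})" for x
  proof -
    have "(\<integral>\<^sup>+u. ennreal (f0 u) * indicator {..x} u \<partial>lborel) = emeasure (distr P lborel (X 0)) {..x}"
      by (subst distributed_distr_eq_density[OF f0], subst emeasure_density) auto
    also have "\<dots> = emeasure P {\<omega>\<in>space P. X 0 \<omega> \<le> x}"
      by (subst emeasure_distr) (auto intro!: arg_cong[of _ _ "emeasure P"])
    finally show ?thesis by (simp add: P.emeasure_eq_measure)
  qed
  have eq: "emeasure (distr P lborel sale) {..x} = emeasure (density lborel g) {..x}" for x
  proof -
    let ?J = "LBINT w:{mu0..?m}. max (F x - F w) 0 / (\<phi> w)\<^sup>2"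
    have J: "0 \<le> ?J" unfolding set_lebesgue_integral_def by (rule Bochner_Integration.integral_nonneg) simp
    have "emeasure (density lborel g) {..x} = (\<integral>\<^sup>+u. ennreal (g u) * indicator {..x} u \<partial>lborel)"
      by (rule emeasure_density) auto
    also have "\<dots> = (\<integral>\<^sup>+u. ennreal (k u) * indicator {..x} u \<partial>lborel)"
      by (rule nn_integral_cong_AE, rule AE_I'[where N="{?m}"]) (auto, metis gk)
    also have "\<dots> = (\<integral>\<^sup>+u. ennreal (\<phi> ?m / \<phi> mu0) * (ennreal (f0 u) * indicator {..x} u)
        + ennreal (\<phi> ?m) * (ennreal (f u) * ennreal (K u) * indicator {..x} u) \<partial>lborel)"
    proof (rule nn_integral_cong)
      fix u
      have "ennreal (k u) = ennreal (\<phi> ?m / \<phi> mu0 * f0 u) + ennreal (\<phi> ?m * (f u * K u))"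
        unfolding k_def using p f_nonneg f0_nonneg K_nonneg
        by (subst ennreal_plus[symmetric]) (auto simp: mult.assoc)
      also have "\<dots> = ennreal (\<phi> ?m / \<phi> mu0) * ennreal (f0 u) + ennreal (\<phi> ?m) * (ennreal (f u) * ennreal (K u))"
        using p f_nonneg f0_nonneg K_nonneg by (simp add: ennreal_mult del: times_divide_eq_left)
      finally show "ennreal (k u) * indicator {..x} u = ennreal (\<phi> ?m / \<phi> mu0) * (ennreal (f0 u) * indicator {..x} u)
        + ennreal (\<phi> ?m) * (ennreal (f u) * ennreal (K u) * indicator {..x} u)"
        by (simp add: indicator_def)
    qed
    also have "\<dots> = ennreal (\<phi> ?m / \<phi> mu0) * ennreal (P.prob {\<omega>\<in>space P. X 0 \<omega> \<le> x})
        + ennreal (\<phi> ?m) * ennreal ?J"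
      by (simp add: nn_integral_add nn_integral_cmult accepted_part residual_part)
    also have "\<dots> = ennreal (price_cdf (P.prob {\<omega>\<in>space P. X 0 \<omega> \<le> x}) x t)"
      using p J unfolding price_cdf_def
      by (simp add: ennreal_mult[symmetric] ennreal_plus[symmetric] distrib_left del: ennreal_plus)
    also have "\<dots> = emeasure P {\<omega>\<in>space P. sale \<omega> \<le> x}"
      by (simp add: P.emeasure_eq_measure sale_cdf)
    also have "\<dots> = emeasure (distr P lborel sale) {..x}"
      by (subst emeasure_distr) (auto intro!: arg_cong[of _ _ "emeasure P"])
    finally show ?thesis ..
  qed
  have "distr P lborel sale = density lborel g"
  proof (rule measure_eqI_generator_eq[where E="range atMost" and \<Omega>=UNIV and A="\<lambda>i. {..real i}"])
    show "Int_stable (range atMost :: real set set)" by (auto simp: Int_stable_def)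
    show "(\<Union>i. {..real i}) = UNIV" using real_arch_simple by auto
    interpret S: prob_space "distr P lborel sale" by (rule P.prob_space_distr) simp
    show "emeasure (distr P lborel sale) {..real i} \<noteq> \<infinity>" for i by simp
  qed (auto simp: eq borel_eq_atMost)
  then show ?thesis by (simp add: distributed_def)
qed

end

theorem theorem3p1:
  fixes P :: "'a measure"
    and lam mu0 t :: real
    and F F0 mu :: "real \<Rightarrow> real"
    and D X :: "nat \<Rightarrow> 'a \<Rightarrow> real"
    and S :: "'a \<Rightarrow> real"
  assumes P: "prob_space P"
    and lam: "lam > 0"
    and indep: "prob_space.indep_vars P (\<lambda>_. borel) (case_sum D X) ({1..} <+> UNIV)"
    and D: "\<And>i. i \<ge> 1 \<Longrightarrow> distributed P lborel (D i) (exponential_density lam)"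
    and X: "\<And>i. i \<ge> 1 \<Longrightarrow> cdf (distr P borel (X i)) = F"
    and X0: "cdf (distr P borel (X 0)) = F0"
    and X_plus: "integrable P (\<lambda>\<omega>. max (X 1 \<omega>) 0)"
    and X0_int: "integrable P (\<lambda>\<omega>. \<bar>X 0 \<omega>\<bar>)"
    and mu0: "mu0 = prob_space.expectation P (X 0)"
    and mu0_nonneg: "0 \<le> mu0"
    and mu0_less: "ereal mu0 < upper_end F"
    and mu: "mu = optimal_policy lam F mu0"
    and t: "t \<ge> 0"
    and S: "S = (\<lambda>\<omega>. sale_price mu t (\<lambda>i. D i \<omega>) (\<lambda>i. X i \<omega>))"
  shows
    "(\<forall>x.
        \<P>(\<omega> in P. S \<omega> \<le> x) =
          phi F (mu t) * (F0 x / phi F mu0 +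
            (LBINT w:{mu0..mu t}. max (F x - F w) 0 / (phi F w)\<^sup>2))
      \<and>
        \<P>(\<omega> in P. S \<omega> \<le> x) =
          phi F (mu t) * (F0 x / phi F mu0) + phi F (mu t) *
            (if x < mu0 then 0
             else if x < mu t then
               1 / phi F x - 1 / phi F mu0
                 + phi_deriv F x * (LBINT w:{mu0..x}. 1 / (phi F w)\<^sup>2)
             else
               1 / phi F (mu t) - 1 / phi F mu0
                 + phi_deriv F x * (LBINT w:{mu0..mu t}. 1 / (phi F w)\<^sup>2)))
     \<and>
     (\<forall>f f0 g :: real \<Rightarrow> real.
        (\<forall>x. f x \<ge> 0) \<longrightarrow> (\<forall>x. f0 x \<ge> 0) \<longrightarrow>
        (\<forall>i\<ge>1. distributed P lborel (X i) f) \<longrightarrow> distributed P lborel (X 0) f0 \<longrightarrow>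
        (\<forall>x. x \<noteq> mu t \<longrightarrow>
           g x = phi F (mu t) * (f0 x / phi F mu0) + phi F (mu t) * f x *
             (if x < mu0 then 0
              else if x < mu t then (LBINT w:{mu0..x}. 1 / (phi F w)\<^sup>2)
              else (LBINT w:{mu0..mu t}. 1 / (phi F w)\<^sup>2))) \<longrightarrow>
        distributed P lborel S g)"
proof -
  interpret P: prob_space P by fact
  have X_meas: "X i \<in> borel_measurable P" for i
    using P.indep_vars_def2[THEN iffD1, OF indep] by force
  define N where "N = distr P borel (X 1)"
  have rd: "real_distribution (distr P borel (X i))" for i
    using X_meas by (rule P.real_distribution_distr)
  have N: "distr P borel (X i) = N" if "1 \<le> i" for i
    unfolding N_def using X[OF that] X[of 1] by (intro cdf_unique rd) simp
  have cdf_N: "cdf N = F" unfolding N_def by (simp add: X)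
  interpret bidding_process N mu0 lam P D X t
  proof (intro bidding_process.intro optimal_pricing.intro offer_distribution.intro
      offer_distribution_axioms.intro optimal_pricing_axioms.intro bidding_process_axioms.intro)
    show "integrable N (\<lambda>x. max x 0)"
      unfolding N_def using X_plus by (subst integrable_distr_eq) (auto intro: X_meas)
    show "real_distribution N" unfolding N_def by (rule rd)
  qed (use P indep D N lam t mu0_less cdf_N in auto)
  have mu_t: "mu t = policy t" using t by (simp add: mu policy_def cdf_N)
  have S_sale: "S = sale"
    unfolding S mu sale_def[abs_def] sale_price_policy[symmetric] cdf_N ..
  have F0: "P.prob {\<omega>\<in>space P. X 0 \<omega> \<le> x} = F0 x" for x
    unfolding X0[symmetric] cdf_def
    by (subst measure_distr) (auto intro!: arg_cong[of _ _ P.prob] simp: X_meas)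
  have law: "\<P>(\<omega> in P. S \<omega> \<le> x) = phi F (mu t) * (F0 x / phi F mu0 +
      (LBINT w:{mu0..mu t}. max (F x - F w) 0 / (phi F w)\<^sup>2))" for x
    using sale_cdf[of x] unfolding price_cdf_def S_sale mu_t F0 cdf_N .
  show ?thesis
  proof (intro conjI allI impI)
    fix x
    show "\<P>(\<omega> in P. S \<omega> \<le> x) = phi F (mu t) * (F0 x / phi F mu0 +
      (LBINT w:{mu0..mu t}. max (F x - F w) 0 / (phi F w)\<^sup>2))" by (rule law)
    show "\<P>(\<omega> in P. S \<omega> \<le> x) = phi F (mu t) * (F0 x / phi F mu0) + phi F (mu t) *
            (if x < mu0 then 0
             else if x < mu t then
               1 / phi F x - 1 / phi F mu0
                 + phi_deriv F x * (LBINT w:{mu0..x}. 1 / (phi F w)\<^sup>2)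
             else
               1 / phi F (mu t) - 1 / phi F mu0
                 + phi_deriv F x * (LBINT w:{mu0..mu t}. 1 / (phi F w)\<^sup>2))"
      using excess_integral_cases[OF policy_in_range[of t], of x]
      unfolding law distrib_left mu_t cdf_N by (simp only:)
  next
    fix f f0 g :: "real \<Rightarrow> real"
    assume "\<forall>x. f x \<ge> 0" "\<forall>x. f0 x \<ge> 0" "\<forall>i\<ge>1. distributed P lborel (X i) f" "distributed P lborel (X 0) f0"
      and "\<forall>x. x \<noteq> mu t \<longrightarrow>
           g x = phi F (mu t) * (f0 x / phi F mu0) + phi F (mu t) * f x *
             (if x < mu0 then 0
              else if x < mu t then (LBINT w:{mu0..x}. 1 / (phi F w)\<^sup>2)
              else (LBINT w:{mu0..mu t}. 1 / (phi F w)\<^sup>2))"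
    then show "distributed P lborel S g"
      unfolding S_sale mu_t by (intro sale_distributed[of f f0]) (simp_all add: cdf_N)
  qed
qed

end
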